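(* Let $q\in\mathbb{C}$ with $0<|q|<1$. Then $$(-q;q)_{\infty}=\frac{1}{(q,q^{4};q^{5})_{\infty}}\sum_{n=0}^{\infty}\frac{q^{2n}a_{2n}(q)}{(q^{2};q^{2})_{n}}-\frac{1}{(q^{2},q^{3};q^{5})_{\infty}}\sum_{n=0}^{\infty}\frac{q^{2n}b_{2n}(q)}{(q^{2};q^{2})_{n}}$$ and $$(-q^{2};q)_{\infty}=\frac{1}{(q^{2},q^{3};q^{5})_{\infty}}\sum_{n=0}^{\infty}\frac{q^{2n}b_{2n+1}(q)}{(q^{2};q^{2})_{n}}-\frac{1}{(q,q^{4};q^{5})_{\infty}}\sum_{n=0}^{\infty}\frac{q^{2n}a_{2n+1}(q)}{(q^{2};q^{2})_{n}}.$$
   Context: Notation: for a base $p$ with $|p|<1$, $(a;p)_\infty=\prod_{k\ge0}(1-ap^k)$, $(a;p)_n=\prod_{k=0}^{n-1}(1-ap^k)$ for $n\ge 0$, and $(a_1,\dots,a_r;p)_n=\prod_i (a_i;p)_n$ (also for $n=\infty$). The Gaussian binomial is $\begin{bmatrix} n\\ k\end{bmatrix}_q=\frac{(q;q)_n}{(q;q)_k(q;q)_{n-k}}$ for integers $0\le k\le n$ and $0$ otherwise. The Schur polynomials are $$a_m(q)=\sum_{j\ge 0} q^{j^2+j}\begin{bmatrix} m-j-2 \\ j\end{bmatrix}_q\ (m\ge 1),\qquad b_m(q)=\sum_{j\ge 0} q^{j^2}\begin{bmatrix} m-j-1 \\ j\end{bmatrix}_q\ (m\ge 0),$$ together with $a_0(q)=1$;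 thus $a_0=1,\ a_1=0,\ b_0=0,\ b_1=1$. *)

theory Defs
  imports "HOL-Analysis.Analysis"
begin

definition qpoch :: "complex \<Rightarrow> complex \<Rightarrow> nat \<Rightarrow> complex" where
  "qpoch a p n = (\<Prod>k<n. 1 - a * p ^ k)"

definition qpoch_inf :: "complex \<Rightarrow> complex \<Rightarrow> complex" where
  "qpoch_inf a p = (\<Prod>k. 1 - a * p ^ k)"

definition qpochs_inf :: "complex list \<Rightarrow> complex \<Rightarrow> complex" where
  "qpochs_inf as p = (\<Prod>a\<leftarrow>as. qpoch_inf a p)"

text \<open>The arguments are integers because the Schur polynomials below use binomials with a
  negative upper entry. These must vanish, even for lower entry 0, which truncated
  subtraction on the naturals would not give.\<close>

definition gauss_binom :: "complex \<Rightarrow> int \<Rightarrow> int \<Rightarrow> complex" where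
  "gauss_binom q n k =
     (if 0 \<le> k \<and> k \<le> n
      then qpoch q q (nat n) / (qpoch q q (nat k) * qpoch q q (nat (n - k)))
      else 0)"

text \<open>Only finitely many terms of the following two series are nonzero. The value at
  \<open>m = 0\<close> of the first family is a separate convention, as the series would give 0 there.\<close>

definition schur_a :: "nat \<Rightarrow> complex \<Rightarrow> complex" where
  "schur_a m q =
     (if m = 0 then 1
      else (\<Sum>j. q ^ (j\<^sup>2 + j) * gauss_binom q (int m - int j - 2) (int j)))"

definition schur_b :: "nat \<Rightarrow> complex \<Rightarrow> complex" where
  "schur_b m q = (\<Sum>j. q ^ (j\<^sup>2) * gauss_binom q (int m - int j - 1) (int j))"

lemma convergent_prod_qpoch:
  fixes a p :: complex
  assumes "norm p < 1"
  shows "convergent_prod (\<lambda>k. 1 - a * p ^ k)"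
proof -
  have "summable (\<lambda>k. norm ((1 - a * p ^ k) - 1))"
    using assms by (simp add: norm_mult norm_power summable_mult summable_geometric)
  then show ?thesis
    by (intro abs_convergent_prod_imp_convergent_prod summable_imp_abs_convergent_prod)
qed

lemma schur_initial_values:
  "schur_a 0 q = 1" "schur_a 1 q = 0" "schur_b 0 q = 0" "schur_b 1 q = 1"
proof -
  have z: "gauss_binom q (int m - int j - i) (int j) = 0" if "int m < 2 * int j + i" for m j i
    using that by (simp add: gauss_binom_def)
  show "schur_a 0 q = 1" by (simp add: schur_a_def)
  show "schur_a 1 q = 0" using z[of 1 _ 2] by (simp add: schur_a_def)
  show "schur_b 0 q = 0" using z[of 0 _ 1] by (simp add: schur_b_def)
  have "(\<Sum>j. q ^ (j\<^sup>2) * gauss_binom q (int 1 - int j - 1) (int j))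
      = (\<Sum>j\<in>{0}. q ^ (j\<^sup>2) * gauss_binom q (int 1 - int j - 1) (int j))"
    by (rule suminf_finite) (use z[of 1 _ 1] in auto)
  then show "schur_b 1 q = 1"
    by (simp add: schur_b_def gauss_binom_def qpoch_def)
qed

end

theory Submission
  imports Defs
begin

text \<open>Write \<open>G(x) = \<Sum>k. q ^ (k\<^sup>2) * x ^ k / (q;q)\<^sub>k\<close> (\<open>rogers_series\<close>). The right-hand
sides of the theorem combine the two families of Schur polynomials with exactly the two
reciprocal products to which \<open>G(1)\<close> and \<open>G(q)\<close> are equal by the Rogers-Ramanujan identities. Both families satisfy
\<open>u (m + 2) = u (m + 1) + q ^ m * u m\<close>, and by \<open>G(x) = G(q x) + q x G(q\<^sup>2 x)\<close> so does
\<open>(-1) ^ m * q ^ (m choose 2) * G(q ^ m)\<close>. Comparing the values at \<open>m = 0\<close> and \<open>m = 1\<close> gives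
the formula of Garrett, Ismail and Stanton (\<open>schur_rogers_combination\<close>)
\<open>a\<^sub>m G(1) - b\<^sub>m G(q) = (-1) ^ m * q ^ (m choose 2) * G(q ^ m)\<close>.

Hence the right-hand sides are the values at \<open>x = 1\<close> and \<open>x = q\<close> of the single function
\<open>F(x) = \<Sum>n. q ^ (2 n\<^sup>2 + n) * x ^ (2 n) / (q\<^sup>2;q\<^sup>2)\<^sub>n * G(x q ^ (2 n))\<close>. The functional equation of
\<open>G\<close> makes \<open>F(x) - (1 + x q) F(x q)\<close> a telescoping series with sum \<open>0\<close>
(\<open>shifted_rogers_sum_functional_eq\<close>). Iterating, with \<open>F(x q ^ n)\<close> tending to \<open>1\<close>, gives
\<open>F(x) = (-x q; q)\<^sub>\<infinity>\<close>, and this is the left-hand side in both cases.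

The Rogers-Ramanujan identities are obtained from Bailey's lemma, in the form used by Bressoud:
applying it twice to a unit Bailey pair gives an identity of finite sums (\<open>bailey_lemma_twice\<close>), whose
limit expresses \<open>G(1)\<close> and \<open>G(q)\<close> as theta series divided by \<open>(q;q)\<^sub>\<infinity>\<close>. The Jacobi triple
product in base \<open>q\<^sup>5\<close> factors these theta series. The triple product itself is the limit of the
finite q-binomial theorem, centred at its middle term. All passages to the limit are instances of
Tannery's theorem.\<close>

section \<open>Reciprocal q-factorials and finite summation formulas\<close>

definition inv_qfact :: "complex \<Rightarrow> nat \<Rightarrow> complex" where
  "inv_qfact q n = 1 / qpoch q q n"

text \<open>The reciprocal of \<open>(q;q)\<^sub>n\<^sub>-\<^sub>r\<close>, extended by \<open>0\<close> to \<open>r > n\<close>, as is usual for q-factorials of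
negative index. This turns sums over \<open>r \<le> n\<close> into series over all \<open>r\<close> and lets telescoping sums
run off their end.\<close>

definition inv_qfact_diff :: "complex \<Rightarrow> nat \<Rightarrow> nat \<Rightarrow> complex" where
  "inv_qfact_diff q n r = (if r \<le> n then inv_qfact q (n - r) else 0)"

lemma qpoch_0 [simp]: "qpoch a q 0 = 1"
  by (simp add: qpoch_def)

lemma qpoch_Suc: "qpoch a q (Suc n) = qpoch a q n * (1 - a * q ^ n)"
  by (simp add: qpoch_def)

lemma norm_power_less_one:
  fixes q :: complex
  assumes "norm q < 1" "0 < n"
  shows "norm (q ^ n) < 1"
  using assms power_Suc_less_one[of "norm q" "n - 1"]
  by (cases "q = 0") (auto simp: norm_power power_0_left)

lemma one_minus_power_nonzero:
  fixes q :: complex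
  assumes "norm q < 1" "0 < n"
  shows "1 - q ^ n \<noteq> 0"
  using norm_power_less_one[OF assms] by auto

lemma qpoch_q_nonzero:
  assumes "norm q < 1"
  shows "qpoch q q n \<noteq> 0"
  using one_minus_power_nonzero[OF assms, of "Suc _"] by (auto simp: qpoch_def)

lemma inv_qfact_0 [simp]: "inv_qfact q 0 = 1"
  by (simp add: inv_qfact_def)

lemma inv_qfact_Suc:
  assumes "norm q < 1"
  shows "(1 - q ^ Suc n) * inv_qfact q (Suc n) = inv_qfact q n"
  using one_minus_power_nonzero[OF assms, of "Suc n"] qpoch_q_nonzero[OF assms, of n]
  by (simp add: inv_qfact_def qpoch_Suc)

text \<open>The recurrence of the reciprocal q-factorial without a side condition: for \<open>r \<ge> n\<close> the
truncated difference makes the factor \<open>1 - q ^ 0\<close> vanish, in agreement with the extension by zero.\<close>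

lemma inv_qfact_diff_step:
  assumes "norm q < 1"
  shows "(1 - q ^ (n - r)) * inv_qfact_diff q n r = inv_qfact_diff q n (Suc r)"
proof (cases "r < n")
  case True
  then obtain m where "n = Suc (r + m)" using less_imp_Suc_add by blast
  then show ?thesis using inv_qfact_Suc[OF assms, of m] by (simp add: inv_qfact_diff_def Suc_diff_le)
qed (auto simp: inv_qfact_diff_def)

text \<open>The q-Pascal rule in summed form, from
\<open>1 - q ^ (M + 1) = (1 - q ^ (M + 1 - k)) + q ^ (M + 1 - k) (1 - q ^ k)\<close>:
each factor on the right lowers one of the two q-factorials. It is the induction step for both
the q-binomial theorem and the q-Vandermonde sum.\<close>

lemma q_pascal_sum:
  assumes "norm q < 1"
  shows "(1 - q ^ Suc M) * (\<Sum>k\<le>Suc M. inv_qfact q k * inv_qfact q (Suc M - k) * h k)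
       = (\<Sum>k\<le>M. inv_qfact q k * inv_qfact q (M - k) * (h k + q ^ (M - k) * h (Suc k)))"
proof -
  let ?e = "inv_qfact q"
  have "(1 - q ^ Suc M) * (\<Sum>k\<le>Suc M. ?e k * ?e (Suc M - k) * h k)
      = (\<Sum>k\<le>Suc M. ?e k * ((1 - q ^ (Suc M - k)) * ?e (Suc M - k)) * h k
          + q ^ (Suc M - k) * ((1 - q ^ k) * ?e k) * ?e (Suc M - k) * h k)"
    unfolding sum_distrib_left
  proof (rule sum.cong[OF refl])
    fix k assume "k \<in> {..Suc M}"
    then have "q ^ Suc M = q ^ (Suc M - k) * q ^ k"
      by (metis atMost_iff le_add_diff_inverse2 power_add)
    then show "(1 - q ^ Suc M) * (?e k * ?e (Suc M - k) * h k)
      = ?e k * ((1 - q ^ (Suc M - k)) * ?e (Suc M - k)) * h k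
          + q ^ (Suc M - k) * ((1 - q ^ k) * ?e k) * ?e (Suc M - k) * h k"
      by (simp add: algebra_simps del: power_Suc)
  qed
  also have "\<dots> = (\<Sum>k\<le>Suc M. ?e k * ((1 - q ^ (Suc M - k)) * ?e (Suc M - k)) * h k)
       + (\<Sum>k\<le>Suc M. q ^ (Suc M - k) * ((1 - q ^ k) * ?e k) * ?e (Suc M - k) * h k)"
    by (rule sum.distrib)
  also have "(\<Sum>k\<le>Suc M. ?e k * ((1 - q ^ (Suc M - k)) * ?e (Suc M - k)) * h k)
       = (\<Sum>k\<le>M. ?e k * ?e (M - k) * h k)"
  proof -
    have "(1 - q ^ (Suc M - k)) * ?e (Suc M - k) = ?e (M - k)" if "k \<le> M" for k
      using inv_qfact_Suc[OF assms, of "M - k"] that by (simp add: Suc_diff_le)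
    then show ?thesis by simp
  qed
  also have "(\<Sum>k\<le>Suc M. q ^ (Suc M - k) * ((1 - q ^ k) * ?e k) * ?e (Suc M - k) * h k)
       = (\<Sum>k\<le>M. ?e k * ?e (M - k) * (q ^ (M - k) * h (Suc k)))"
  proof -
    have "q ^ (Suc M - Suc k) * ((1 - q ^ Suc k) * ?e (Suc k)) * ?e (Suc M - Suc k) * h (Suc k)
        = ?e k * ?e (M - k) * (q ^ (M - k) * h (Suc k))" for k
      unfolding inv_qfact_Suc[OF assms] by simp
    then show ?thesis unfolding sum.atMost_Suc_shift by (simp only: diff_self_eq_0) simp
  qed
  finally show ?thesis by (simp only: sum.distrib distrib_left)
qed

lemma finite_q_binomial:
  assumes "norm q < 1"
  shows "(\<Sum>k\<le>M. inv_qfact q k * inv_qfact q (M - k) * ((-1) ^ k * q ^ (k choose 2) * z ^ k))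
       = inv_qfact q M * qpoch z q M"
proof (induction M)
  case (Suc M)
  let ?h = "\<lambda>k. (-1) ^ k * q ^ (k choose 2) * z ^ k"
  have "?h k + q ^ (M - k) * ?h (Suc k) = (1 - z * q ^ M) * ?h k" if "k \<le> M" for k
  proof -
    have "q ^ M = q ^ (M - k) * q ^ k" using that by (metis le_add_diff_inverse2 power_add)
    then show ?thesis by (simp add: numeral_2_eq_2 power_add algebra_simps)
  qed
  note step = this
  have "(1 - q ^ Suc M) * (\<Sum>k\<le>Suc M. inv_qfact q k * inv_qfact q (Suc M - k) * ?h k)
      = (\<Sum>k\<le>M. inv_qfact q k * inv_qfact q (M - k) * (?h k + q ^ (M - k) * ?h (Suc k)))"
    by (rule q_pascal_sum[OF assms])
  also have "\<dots> = (\<Sum>k\<le>M. (1 - z * q ^ M) * (inv_qfact q k * inv_qfact q (M - k) * ?h k))"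
    by (intro sum.cong refl, subst step) (simp_all add: algebra_simps)
  also have "\<dots> = (1 - z * q ^ M) * (\<Sum>k\<le>M. inv_qfact q k * inv_qfact q (M - k) * ?h k)"
    by (simp only: sum_distrib_left)
  also have "\<dots> = (1 - q ^ Suc M) * (inv_qfact q (Suc M) * qpoch z q (Suc M))"
    unfolding Suc.IH qpoch_Suc by (simp add: inv_qfact_Suc[OF assms, of M, symmetric] algebra_simps)
  finally show ?case using one_minus_power_nonzero[OF assms, of "Suc M"] by simp
qed (simp add: numeral_2_eq_2)

text \<open>A case of the q-Chu-Vandermonde sum. The shift \<open>d\<close> has to vary in the induction, because
the second half of the q-Pascal rule produces the same sum with \<open>d + 1\<close>.\<close>

lemma q_vandermonde:
  assumes "norm q < 1"
  shows "(\<Sum>i\<le>M. inv_qfact q i * inv_qfact q (M - i) * (q ^ (i * (i + d)) * inv_qfact q (i + d)))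
       = inv_qfact q M * inv_qfact q (M + d)"
proof (induction M arbitrary: d)
  case (Suc M)
  let ?e = "inv_qfact q"
  let ?V = "\<lambda>M d. \<Sum>i\<le>M. ?e i * ?e (M - i) * (q ^ (i * (i + d)) * ?e (i + d))"
  have pow: "q ^ (M - i) * q ^ (Suc i * (Suc i + d)) = q ^ (Suc M + d) * q ^ (i * (i + Suc d))"
    if "i \<le> M" for i
  proof -
    have "M - i + Suc i * (Suc i + d) = Suc M + d + i * (i + Suc d)"
      using that by (simp add: algebra_simps)
    then show ?thesis by (simp only: flip: power_add)
  qed
  have "(1 - q ^ Suc M) * ?V (Suc M) d
      = (\<Sum>i\<le>M. ?e i * ?e (M - i) * (q ^ (i * (i + d)) * ?e (i + d)
           + q ^ (M - i) * (q ^ (Suc i * (Suc i + d)) * ?e (Suc i + d))))"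
    by (rule q_pascal_sum[OF assms])
  also have "\<dots> = ?V M d + q ^ (Suc M + d) * ?V M (Suc d)"
    unfolding sum_distrib_left sum.distrib[symmetric]
  proof (rule sum.cong[OF refl])
    fix i assume "i \<in> {..M}"
    then show "?e i * ?e (M - i) * (q ^ (i * (i + d)) * ?e (i + d)
           + q ^ (M - i) * (q ^ (Suc i * (Suc i + d)) * ?e (Suc i + d)))
       = ?e i * ?e (M - i) * (q ^ (i * (i + d)) * ?e (i + d))
         + q ^ (Suc M + d) * (?e i * ?e (M - i) * (q ^ (i * (i + Suc d)) * ?e (i + Suc d)))"
      using pow[of i] by (simp only: atMost_iff mult.assoc[symmetric] distrib_left)
         (simp only: mult_ac add_Suc add_Suc_right)
  qed
  also have "\<dots> = ?e M * ?e (M + d) + q ^ (Suc M + d) * (?e M * ?e (M + Suc d))"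
    by (simp only: Suc.IH)
  also have "\<dots> = ?e M * ?e (Suc M + d)"
    by (simp add: inv_qfact_Suc[OF assms, of "M + d", symmetric] algebra_simps)
  also have "\<dots> = (1 - q ^ Suc M) * (?e (Suc M) * ?e (Suc M + d))"
    using inv_qfact_Suc[OF assms, of M] by (simp only: mult.assoc[symmetric])
  finally show ?case using one_minus_power_nonzero[OF assms, of "Suc M"] by simp
qed simp

text \<open>Bailey's lemma relative to \<open>a = q ^ c\<close>, with both parameters sent to infinity. After
exchanging the sums, the inner sum over \<open>s = r + i\<close> is a q-Vandermonde sum with shift \<open>2 r + c\<close>. A pair
\<open>\<alpha>, \<beta>\<close> is thereby turned into a new pair of the same kind, so that the lemma can be iterated.\<close>

lemma bailey_lemma:
  assumes "norm q < 1"
    and pair: "\<And>s. \<beta> s = (\<Sum>r\<le>s. \<alpha> r * inv_qfact q (s - r) * inv_qfact q (s + r + c))"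
  shows "(\<Sum>s\<le>N. q ^ (s * (s + c)) * \<beta> s * inv_qfact q (N - s))
       = (\<Sum>r\<le>N. q ^ (r * (r + c)) * \<alpha> r * inv_qfact q (N - r) * inv_qfact q (N + r + c))"
proof -
  let ?e = "inv_qfact q"
  have "(\<Sum>s\<le>N. q ^ (s * (s + c)) * \<beta> s * ?e (N - s))
      = (\<Sum>s\<le>N. \<Sum>r\<le>s. q ^ (s * (s + c)) * \<alpha> r * ?e (s - r) * ?e (s + r + c) * ?e (N - s))"
    by (simp add: pair sum_distrib_left sum_distrib_right mult_ac)
  also have "\<dots> = (\<Sum>r\<le>N. \<Sum>s\<in>{r..N}. q ^ (s * (s + c)) * \<alpha> r * ?e (s - r) * ?e (s + r + c) * ?e (N - s))"
    by (simp add: sum.Sigma) (rule sum.reindex_bij_witness[of _ "\<lambda>(r, s). (s, r)" "\<lambda>(s, r). (r, s)"]; force)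
  also have "\<dots> = (\<Sum>r\<le>N. q ^ (r * (r + c)) * \<alpha> r * ?e (N - r) * ?e (N + r + c))"
  proof (rule sum.cong[OF refl])
    fix r assume "r \<in> {..N}"
    then have rN: "r \<le> N" by simp
    define M where "M = N - r"
    have N: "N = M + r" using rN by (simp add: M_def)
    have ex: "(i + r) * (i + r + c) = r * (r + c) + i * (i + (2 * r + c))" for i
      by (simp add: algebra_simps)
    have "(\<Sum>s\<in>{r..N}. q ^ (s * (s + c)) * \<alpha> r * ?e (s - r) * ?e (s + r + c) * ?e (N - s))
        = (\<Sum>i\<le>M. q ^ ((i + r) * (i + r + c)) * \<alpha> r * ?e i * ?e (i + (2 * r + c)) * ?e (M - i))"
      by (rule sum.reindex_bij_witness[of _ "\<lambda>i. i + r" "\<lambda>s. s - r"]) (auto simp: N algebra_simps mult_2)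
    also have "\<dots> = q ^ (r * (r + c)) * \<alpha> r * (\<Sum>i\<le>M. ?e i * ?e (M - i) * (q ^ (i * (i + (2 * r + c))) * ?e (i + (2 * r + c))))"
      unfolding ex power_add sum_distrib_left by (intro sum.cong) (simp_all only: mult_ac)
    also have "\<dots> = q ^ (r * (r + c)) * \<alpha> r * ?e (N - r) * ?e (N + r + c)"
    proof -
      have "M + (2 * r + c) = N + r + c" by (simp add: N)
      then show ?thesis
        unfolding q_vandermonde[OF assms(1)] by (simp only: M_def[symmetric] mult.assoc)
    qed
    finally show "(\<Sum>s\<in>{r..N}. q ^ (s * (s + c)) * \<alpha> r * ?e (s - r) * ?e (s + r + c) * ?e (N - s))
        = q ^ (r * (r + c)) * \<alpha> r * ?e (N - r) * ?e (N + r + c)" .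
  qed
  finally show ?thesis .
qed

section \<open>Bailey pairs\<close>

lemma sum_atMost_telescope:
  fixes U :: "nat \<Rightarrow> complex"
  assumes "\<And>r. r \<le> n \<Longrightarrow> c * T r = U r - U (Suc r)"
  shows "c * (\<Sum>r\<le>n. T r) = U 0 - U (Suc n)"
  using assms by (simp add: sum_distrib_left sum_telescope)

text \<open>The unit Bailey pair for \<open>a = 1\<close>; the terms for \<open>r\<close> and \<open>-r\<close> of the bilateral sum
\<open>\<Sum>r. (-1) ^ r q ^ (r (r - 1) / 2)\<close> are collected, which is why \<open>r = 0\<close> has a weight of its own.
For \<open>n > 0\<close> the sum telescopes once it is multiplied by \<open>1 - q ^ n\<close>.\<close>

lemma unit_bailey_pair_one:
  assumes "norm q < 1"
  shows "(\<Sum>r\<le>n. (1 + (if r = 0 then 0 else q ^ r)) * ((-1) ^ r * q ^ (r choose 2))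
            * inv_qfact q (n - r) * inv_qfact q (n + r + 0)) = (if n = 0 then 1 else 0)"
proof (cases "n = 0")
  case False
  define T where "T r = (1 + (if r = 0 then 0 else q ^ r)) * ((-1) ^ r * q ^ (r choose 2))
            * inv_qfact q (n - r) * inv_qfact q (n + r + 0)" for r
  \<comment> \<open>\<open>- U r\<close> is \<open>1 - q ^ n\<close> times the sum of the first \<open>r\<close> terms, a closed form visible from
    small \<open>r\<close>. The empty sum at \<open>r = 0\<close> is not covered by the formula.\<close>
  define U where "U r = (if r = 0 then 0 else (-1) ^ r * q ^ (r choose 2)
            * inv_qfact_diff q n r * inv_qfact q (n + r - 1))" for r
  have "(1 - q ^ n) * T r = U r - U (Suc r)" if "r \<le> n" for r
  proof -
    define p where "p = q ^ (n - r)"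
    define d where "d = inv_qfact q (n - r)"
    have qn: "q ^ n = q ^ r * p" using that by (simp add: p_def flip: power_add)
    have d: "inv_qfact_diff q n r = d" using that by (simp add: inv_qfact_diff_def d_def)
    have d': "inv_qfact_diff q n (Suc r) = (1 - p) * d"
      using inv_qfact_diff_step[OF assms, of n r] by (simp add: d p_def)
    show ?thesis
    proof (cases r)
      case 0
      then show ?thesis using qn d' by (simp add: T_def U_def d_def numeral_2_eq_2)
    next
      case (Suc k)
      have e: "inv_qfact q (n + k) = (1 - q ^ r * q ^ n) * inv_qfact q (n + r)"
        using inv_qfact_Suc[OF assms, of "n + k"] by (simp add: Suc power_add mult_ac)
      have c: "q ^ (Suc r choose 2) = q ^ r * q ^ (r choose 2)"
        by (simp add: numeral_2_eq_2 power_add)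
      have "T r = (1 + q ^ r) * ((-1) ^ r * q ^ (r choose 2)) * d * inv_qfact q (n + r)"
        using Suc by (simp add: T_def d_def)
      moreover have "U r = (-1) ^ r * q ^ (r choose 2) * d * ((1 - q ^ r * q ^ n) * inv_qfact q (n + r))"
        using Suc e d by (simp add: U_def)
      moreover have "U (Suc r) = - ((-1) ^ r * (q ^ r * q ^ (r choose 2)) * ((1 - p) * d) * inv_qfact q (n + r))"
        by (simp add: U_def d' c)
      ultimately show ?thesis unfolding qn by (simp only:) (simp add: algebra_simps)
    qed
  qed
  then have "(1 - q ^ n) * (\<Sum>r\<le>n. T r) = U 0 - U (Suc n)" by (rule sum_atMost_telescope)
  then have "(1 - q ^ n) * (\<Sum>r\<le>n. T r) = 0" by (simp add: U_def inv_qfact_diff_def)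
  then show ?thesis using one_minus_power_nonzero[OF assms, of n] False by (simp add: T_def)
qed (simp add: numeral_2_eq_2)

text \<open>The unit Bailey pair for \<open>a = q\<close>, where the terms for \<open>r\<close> and \<open>-r - 1\<close> are collected.
Again a factor \<open>1 - q ^ n\<close> makes the sum telescope.\<close>

lemma unit_bailey_pair_q:
  assumes "norm q < 1"
  shows "(\<Sum>r\<le>n. (1 - q ^ (2 * r + 1)) * ((-1) ^ r * q ^ (r choose 2))
            * inv_qfact q (n - r) * inv_qfact q (n + r + 1)) = (if n = 0 then 1 else 0)"
proof (cases "n = 0")
  case True
  then show ?thesis using inv_qfact_Suc[OF assms, of 0] by (simp add: numeral_2_eq_2)
next
  case False
  define T where "T r = (1 - q ^ (2 * r + 1)) * ((-1) ^ r * q ^ (r choose 2))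
            * inv_qfact q (n - r) * inv_qfact q (n + r + 1)" for r
  \<comment> \<open>As before, \<open>- U r\<close> is a closed form of the multiplied partial sums; here the factor
    \<open>1 - q ^ r\<close> takes care of \<open>r = 0\<close>.\<close>
  define U where "U r = (-1) ^ r * q ^ (r choose 2) * (1 - q ^ r)
            * inv_qfact_diff q n r * inv_qfact q (n + r)" for r
  have "(1 - q ^ n) * T r = U r - U (Suc r)" if "r \<le> n" for r
  proof -
    define p where "p = q ^ (n - r)"
    define d where "d = inv_qfact q (n - r)"
    define E where "E = inv_qfact q (Suc (n + r))"
    have qn: "q ^ n = q ^ r * p" using that by (simp add: p_def flip: power_add)
    have d: "inv_qfact_diff q n r = d" using that by (simp add: inv_qfact_diff_def d_def)
    have d': "inv_qfact_diff q n (Suc r) = (1 - p) * d"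
      using inv_qfact_diff_step[OF assms, of n r] by (simp add: d p_def)
    have e: "inv_qfact q (n + r) = (1 - q * q ^ r * q ^ n) * E"
      using inv_qfact_Suc[OF assms, of "n + r"] by (simp add: E_def power_add mult_ac)
    have c: "q ^ (Suc r choose 2) = q ^ r * q ^ (r choose 2)"
      by (simp add: numeral_2_eq_2 power_add)
    have "T r = (1 - q ^ r * q ^ r * q) * ((-1) ^ r * q ^ (r choose 2)) * d * E"
      by (simp add: T_def power_add mult_2 flip: d_def E_def)
    moreover have "U r = (-1) ^ r * q ^ (r choose 2) * (1 - q ^ r) * d * ((1 - q * q ^ r * q ^ n) * E)"
      by (simp add: U_def d e)
    moreover have "U (Suc r) = - ((-1) ^ r * (q ^ r * q ^ (r choose 2)) * (1 - q * q ^ r) * ((1 - p) * d) * E)"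
      by (simp add: U_def d' c E_def)
    ultimately show ?thesis unfolding qn by (simp only:) (simp add: algebra_simps)
  qed
  then have "(1 - q ^ n) * (\<Sum>r\<le>n. T r) = U 0 - U (Suc n)" by (rule sum_atMost_telescope)
  then have "(1 - q ^ n) * (\<Sum>r\<le>n. T r) = 0" by (simp add: U_def inv_qfact_diff_def)
  then show ?thesis using one_minus_power_nonzero[OF assms, of n] False by (simp add: T_def)
qed

text \<open>The first application of Bailey's lemma to the unit pair leaves only the term \<open>j = 0\<close> on the
left and yields \<open>\<beta> s = 1 / (q;q)\<^sub>s\<close>; the second one produces the Rogers-Ramanujan sum in
finite form.\<close>

lemma bailey_lemma_twice:
  assumes "norm q < 1"
    and unit: "\<And>n. (\<Sum>r\<le>n. \<alpha> r * inv_qfact q (n - r) * inv_qfact q (n + r + c)) = (if n = 0 then 1 else 0)"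
  shows "(\<Sum>s\<le>N. q ^ (s * (s + c)) * inv_qfact q s * inv_qfact q (N - s))
       = (\<Sum>r\<le>N. q ^ (r * (r + c)) * (q ^ (r * (r + c)) * \<alpha> r)
            * inv_qfact q (N - r) * inv_qfact q (N + r + c))"
proof (rule bailey_lemma[OF assms(1)])
  fix s
  have "(\<Sum>j\<le>s. q ^ (j * (j + c)) * (if j = 0 then 1 else 0) * inv_qfact q (s - j))
      = (\<Sum>r\<le>s. q ^ (r * (r + c)) * \<alpha> r * inv_qfact q (s - r) * inv_qfact q (s + r + c))"
    by (rule bailey_lemma[OF assms(1)]) (simp only: unit)
  moreover have "(\<Sum>j\<le>s. q ^ (j * (j + c)) * (if j = 0 then 1 else 0) * inv_qfact q (s - j))
      = (\<Sum>j\<in>{0}. q ^ (j * (j + c)) * (if j = 0 then 1 else 0) * inv_qfact q (s - j))"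
    by (rule sum.mono_neutral_right) auto
  ultimately show "inv_qfact q s
      = (\<Sum>r\<le>s. q ^ (r * (r + c)) * \<alpha> r * inv_qfact q (s - r) * inv_qfact q (s + r + c))"
    by simp
qed

section \<open>Limits of q-factorials and of weighted sums\<close>

lemma qpoch_LIMSEQ:
  assumes "norm q < 1"
  shows "qpoch a q \<longlonglongrightarrow> qpoch_inf a q"
  using convergent_prod_LIMSEQ[OF convergent_prod_qpoch[OF assms, of a]]
  by (simp add: qpoch_def [abs_def] qpoch_inf_def LIMSEQ_lessThan_iff_atMost)

lemma qpoch_inf_nonzero:
  assumes "norm q < 1" "norm a < 1"
  shows "qpoch_inf a q \<noteq> 0"
  unfolding qpoch_inf_def
proof (rule prodinf_nonzero[OF convergent_prod_qpoch[OF assms(1)]])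
  fix k
  have "norm (a * q ^ k) \<le> norm a * 1"
    unfolding norm_mult norm_power using assms by (intro mult_left_mono power_le_one) auto
  then have "norm (a * q ^ k) < 1" using assms by simp
  then show "1 - a * q ^ k \<noteq> 0" by auto
qed

lemma inv_qfact_LIMSEQ:
  assumes "norm q < 1"
  shows "inv_qfact q \<longlonglongrightarrow> 1 / qpoch_inf q q"
  unfolding inv_qfact_def [abs_def]
  by (intro tendsto_intros qpoch_LIMSEQ qpoch_inf_nonzero assms)

lemma inv_qfact_bounded:
  assumes "norm q < 1"
  obtains C where "C > 0" "\<And>n. norm (inv_qfact q n) \<le> C"
  using convergent_imp_Bseq[OF convergentI[OF inv_qfact_LIMSEQ[OF assms]]] by (auto simp: Bseq_def)

lemma tannery_sequentially:
  fixes a :: "nat \<Rightarrow> nat \<Rightarrow> complex"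
  assumes "\<And>k. (\<lambda>N. a N k) \<longlonglongrightarrow> b k" and "\<And>N k. norm (a N k) \<le> M k" and "summable M"
  shows "(\<lambda>N. \<Sum>k. a N k) \<longlonglongrightarrow> (\<Sum>k. b k)"
proof -
  have "eventually (\<lambda>(k, N). norm (a N k) \<le> M k) (at_top \<times>\<^sub>F sequentially)"
    using assms(2) by (intro always_eventually) auto
  from tannerys_theorem[OF assms(1) this assms(3)] show ?thesis by simp
qed

text \<open>Tannery's theorem for weights with a common limit and a common bound. The weights below
are reciprocal q-factorials, so that \<open>L\<close> is a power of \<open>1 / (q;q)\<^sub>\<infinity>\<close>.\<close>

lemma suminf_weighted_LIMSEQ:
  fixes f :: "nat \<Rightarrow> complex"
  assumes "summable (\<lambda>s. norm (f s))" and "\<And>s. (\<lambda>N. g N s) \<longlonglongrightarrow> L" and "\<And>N s. norm (g N s) \<le> C"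
  shows "(\<lambda>N. \<Sum>s. f s * g N s) \<longlonglongrightarrow> (\<Sum>s. f s) * L"
proof -
  have "(\<lambda>N. \<Sum>s. f s * g N s) \<longlonglongrightarrow> (\<Sum>s. f s * L)"
  proof (rule tannery_sequentially)
    show "(\<lambda>N. f s * g N s) \<longlonglongrightarrow> f s * L" for s by (intro tendsto_intros assms)
    show "norm (f s * g N s) \<le> norm (f s) * C" for s N
      unfolding norm_mult by (intro mult_left_mono assms) simp
    show "summable (\<lambda>s. norm (f s) * C)" by (intro summable_mult2 assms)
  qed
  then show ?thesis using suminf_mult2[OF summable_norm_cancel[OF assms(1)]] by simp
qed

lemma inv_qfact_diff_LIMSEQ:
  assumes "norm q < 1"
  shows "(\<lambda>n. inv_qfact_diff q n r) \<longlonglongrightarrow> 1 / qpoch_inf q q"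
proof (rule LIMSEQ_offset[where k = r])
  show "(\<lambda>n. inv_qfact_diff q (n + r) r) \<longlonglongrightarrow> 1 / qpoch_inf q q"
    using inv_qfact_LIMSEQ[OF assms] by (simp add: inv_qfact_diff_def)
qed

lemma inv_qfact_diff_norm_le:
  assumes "C > 0" "\<And>n. norm (inv_qfact q n) \<le> C"
  shows "norm (inv_qfact_diff q n r) \<le> C"
  using assms by (simp add: inv_qfact_diff_def)

lemma suminf_inv_qfact_diff_LIMSEQ:
  assumes "norm q < 1" "summable (\<lambda>s. norm (f s))"
  shows "(\<lambda>N. \<Sum>s. f s * inv_qfact_diff q N s) \<longlonglongrightarrow> (\<Sum>s. f s) * (1 / qpoch_inf q q)"
proof -
  obtain C where "C > 0" "\<And>n. norm (inv_qfact q n) \<le> C" using inv_qfact_bounded[OF assms(1)] by blast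
  then show ?thesis
    by (intro suminf_weighted_LIMSEQ[where C = C] assms inv_qfact_diff_LIMSEQ inv_qfact_diff_norm_le)
qed

text \<open>The offset \<open>d\<close> is needed for the half of the triple product with negative exponents, which starts
at distance \<open>1\<close> from the centre and therefore has \<open>c = d = 1\<close>; for a Bailey pair \<open>d = 0\<close>.\<close>

lemma suminf_inv_qfact_diff_sum_LIMSEQ:
  assumes "norm q < 1" "summable (\<lambda>s. norm (f s))"
  shows "(\<lambda>N. \<Sum>s. f s * (inv_qfact_diff q N (s + d) * inv_qfact q (N + (s + c))))
           \<longlonglongrightarrow> (\<Sum>s. f s) * (1 / qpoch_inf q q * (1 / qpoch_inf q q))"
proof -
  obtain C where C: "C > 0" "\<And>n. norm (inv_qfact q n) \<le> C" using inv_qfact_bounded[OF assms(1)] by blast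
  have "norm (inv_qfact_diff q N (s + d) * inv_qfact q (N + (s + c))) \<le> C * C" for N s
    unfolding norm_mult using C by (intro mult_mono inv_qfact_diff_norm_le) auto
  then show ?thesis
    by (intro suminf_weighted_LIMSEQ[where C = "C * C"] assms tendsto_mult inv_qfact_diff_LIMSEQ
          LIMSEQ_ignore_initial_segment inv_qfact_LIMSEQ)
qed

lemma suminf_inv_qfact_diff:
  "(\<Sum>s. f s * (inv_qfact_diff q N (s + d) * h s))
     = (\<Sum>s<Suc N - d. f s * (inv_qfact q (N - (s + d)) * h s))"
proof -
  have "(\<Sum>s. f s * (inv_qfact_diff q N (s + d) * h s))
      = (\<Sum>s<Suc N - d. f s * (inv_qfact_diff q N (s + d) * h s))"
    by (rule suminf_finite) (auto simp: inv_qfact_diff_def)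
  also have "\<dots> = (\<Sum>s<Suc N - d. f s * (inv_qfact q (N - (s + d)) * h s))"
    by (rule sum.cong) (auto simp: inv_qfact_diff_def)
  finally show ?thesis .
qed

text \<open>The ratio of consecutive terms is \<open>q ^ k * x\<close>, so there is convergence for every \<open>x\<close>.\<close>

lemma summable_gaussian:
  fixes q x :: complex
  assumes "norm q < 1"
  shows "summable (\<lambda>k. norm (q ^ (k choose 2) * x ^ k))"
proof -
  have "(\<lambda>k. norm (q ^ k * x)) \<longlonglongrightarrow> 0"
    using assms by (intro tendsto_norm_zero tendsto_mult_left_zero LIMSEQ_power_zero)
  then have "eventually (\<lambda>k. norm (q ^ k * x) < 1 / 2) sequentially"
    by (rule order_tendstoD) simp
  then obtain N where N: "\<And>k. k \<ge> N \<Longrightarrow> norm (q ^ k * x) < 1 / 2"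
    by (auto simp: eventually_at_top_linorder)
  show ?thesis
  proof (rule summable_ratio_test[of "1 / 2" N])
    fix k assume "N \<le> k"
    have "norm (q ^ (Suc k choose 2) * x ^ Suc k) = norm (q ^ k * x) * norm (q ^ (k choose 2) * x ^ k)"
      by (simp add: numeral_2_eq_2 norm_mult norm_power power_add)
    also have "\<dots> \<le> 1 / 2 * norm (q ^ (k choose 2) * x ^ k)"
      using N[OF \<open>N \<le> k\<close>] by (intro mult_right_mono) auto
    finally show "norm (norm (q ^ (Suc k choose 2) * x ^ Suc k)) \<le> 1 / 2 * norm (norm (q ^ (k choose 2) * x ^ k))"
      by simp
  qed simp
qed

section \<open>The Jacobi triple product\<close>

lemma choose_two_Suc: "Suc n choose 2 = n + (n choose 2)"
  by (simp add: numeral_2_eq_2)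

lemma square_eq_choose_two: "k * k = 2 * (k choose 2) + k"
  by (induction k) (auto simp: numeral_2_eq_2)

lemma choose_two_add: "(m + n) choose 2 = (m choose 2) + m * n + (n choose 2)"
  by (induction n) (auto simp: numeral_2_eq_2)

lemma qpoch_add: "qpoch a q (m + n) = qpoch a q m * qpoch (a * q ^ m) q n"
  by (induction n) (auto simp: qpoch_Suc power_add)

lemma qpoch_div_power:
  fixes q x y :: complex
  assumes "x * y = q" "q \<noteq> 0"
  shows "qpoch (x / q ^ n) q n = (- x) ^ n / q ^ (Suc n choose 2) * qpoch y q n"
proof -
  have "qpoch (x / q ^ n) q n = (\<Prod>k<n. 1 - x / q ^ n * q ^ (n - Suc k))"
    unfolding qpoch_def by (rule prod.nat_diff_reindex[symmetric])
  also have "\<dots> = (\<Prod>k<n. - (x / q ^ Suc k) * (1 - y * q ^ k))"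
  proof (rule prod.cong[OF refl])
    fix k assume "k \<in> {..<n}"
    then have "q ^ n = q ^ (n - Suc k) * q ^ Suc k" by (metis Suc_leI le_add_diff_inverse2 lessThan_iff power_add)
    then have "x / q ^ n * q ^ (n - Suc k) = x / q ^ Suc k" using assms by (simp add: divide_simps)
    moreover have "x / q ^ Suc k * (y * q ^ k) = 1" using assms by (auto simp: divide_simps)
    moreover have "1 - u = - u * (1 - v)" if "u * v = 1" for u v :: complex
      using that by (simp add: algebra_simps)
    ultimately show "1 - x / q ^ n * q ^ (n - Suc k) = - (x / q ^ Suc k) * (1 - y * q ^ k)"
      by (simp only:)
  qed
  also have "\<dots> = (\<Prod>k<n. - (x / q ^ Suc k)) * qpoch y q n"
    unfolding qpoch_def by (rule prod.distrib)
  also have "(\<Prod>k<n. - (x / q ^ Suc k)) = (- x) ^ n / q ^ (Suc n choose 2)"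
    by (induction n) (auto simp: choose_two_Suc power_add numeral_2_eq_2 mult_ac)
  finally show ?thesis .
qed

text \<open>The q-binomial theorem with \<open>2 n\<close> factors and argument \<open>x / q ^ n\<close>, multiplied by a
normalising constant. Terms to the right of the middle index \<open>n\<close> give the powers of \<open>x\<close>; those
to its left give the powers of \<open>1 / x\<close>, which are expressed by \<open>y = q / x\<close> so that only natural
exponents occur.\<close>

lemma finite_jacobi_triple_product:
  fixes q x y :: complex
  assumes "norm q < 1" "q \<noteq> 0" "x * y = q"
  shows "(\<Sum>r<Suc n. (-1) ^ r * q ^ (r choose 2) * x ^ r * (inv_qfact q (n - r) * inv_qfact q (n + r)))
       + (\<Sum>i<n. (-1) ^ Suc i * q ^ (Suc i choose 2) * y ^ Suc i * (inv_qfact q (n - Suc i) * inv_qfact q (n + Suc i)))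
       = inv_qfact q (2 * n) * qpoch x q n * qpoch y q n" (is "?A + ?B = _")
proof -
  have xy: "x \<noteq> 0" "y \<noteq> 0" using assms by auto
  define z where "z = x / q ^ n"
  \<comment> \<open>The factor that relates the terms in \<open>z\<close> to the centred terms in \<open>x\<close> and \<open>y\<close>;
    \<open>qpoch_div_power\<close> produces the same factor, so it cancels.\<close>
  define K where "K = (- x) ^ n / q ^ (Suc n choose 2)"
  have K0: "K \<noteq> 0" using xy assms by (simp add: K_def)
  let ?t = "\<lambda>k. (-1) ^ k * q ^ (k choose 2) * z ^ k"
  have t1: "?t (n + r) = K * ((-1) ^ r * q ^ (r choose 2) * x ^ r)" for r
  proof -
    have "(n + r choose 2) + (Suc n choose 2) = (r choose 2) + n * (n + r)"
      using square_eq_choose_two[of n] by (simp add: choose_two_add choose_two_Suc algebra_simps)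
    then have "q ^ (n + r choose 2) * q ^ (Suc n choose 2) = q ^ (r choose 2) * q ^ (n * (n + r))"
      by (simp only: flip: power_add)
    then have "q ^ (n + r choose 2) / q ^ (n * (n + r)) = q ^ (r choose 2) / q ^ (Suc n choose 2)"
      using assms by (simp add: frac_eq_eq)
    moreover have "?t (n + r) = (-1) ^ (n + r) * x ^ (n + r) * (q ^ (n + r choose 2) / q ^ (n * (n + r)))"
      by (simp add: z_def power_divide power_mult)
    ultimately show ?thesis by (simp add: K_def power_add power_minus[of x])
  qed
  have t2: "?t (n - Suc i) = K * ((-1) ^ Suc i * q ^ (Suc i choose 2) * y ^ Suc i)" if "i < n" for i
  proof -
    define m where "m = n - Suc i"
    have n: "n = m + Suc i" using that by (simp add: m_def)
    have y: "y = q / x" using assms xy by (simp add: field_simps)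
    have "(m choose 2) + (Suc n choose 2) = (Suc i choose 2) + Suc i + n * m"
      using square_eq_choose_two[of m] choose_two_add[of m "Suc (Suc i)"]
      by (simp add: n choose_two_Suc algebra_simps)
    then have "q ^ (m choose 2) * q ^ (Suc n choose 2) = q ^ (Suc i choose 2) * q ^ Suc i * q ^ (n * m)"
      by (simp only: flip: power_add)
    then have "q ^ (m choose 2) / q ^ (n * m) = q ^ (Suc i choose 2) * q ^ Suc i / q ^ (Suc n choose 2)"
      using assms by (simp add: frac_eq_eq)
    moreover have "?t m = (-1) ^ m * x ^ m * (q ^ (m choose 2) / q ^ (n * m))"
      by (simp add: z_def power_divide power_mult)
    moreover have "(- x) ^ n * (-1) ^ Suc i = (-1) ^ m * (x ^ m * x ^ Suc i)"
    proof -
      have "(-1) ^ Suc i * (-1) ^ Suc i = (1 :: complex)" by (simp flip: power_mult_distrib)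
      then show ?thesis by (simp add: n power_add power_minus[of x] del: power_Suc add_Suc_right)
    qed
    then have "(- x) ^ n * (-1) ^ Suc i * y ^ Suc i = (-1) ^ m * x ^ m * q ^ Suc i"
      using xy by (simp add: y power_divide del: power_Suc)
    ultimately show ?thesis unfolding K_def m_def[symmetric] by (simp add: mult_ac del: power_Suc)
  qed
  have "inv_qfact q (2 * n) * qpoch z q (2 * n)
      = (\<Sum>k\<le>2 * n. inv_qfact q k * inv_qfact q (2 * n - k) * ?t k)"
    by (rule finite_q_binomial[OF assms(1), symmetric])
  also have "{..2 * n} = {..<n} \<union> {n..2 * n}" by auto
  also have "(\<Sum>k\<in>{..<n} \<union> {n..2 * n}. inv_qfact q k * inv_qfact q (2 * n - k) * ?t k)
      = (\<Sum>k<n. inv_qfact q k * inv_qfact q (2 * n - k) * ?t k)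
        + (\<Sum>k\<in>{n..2 * n}. inv_qfact q k * inv_qfact q (2 * n - k) * ?t k)"
    by (rule sum.union_disjoint) auto
  also have "(\<Sum>k<n. inv_qfact q k * inv_qfact q (2 * n - k) * ?t k)
      = (\<Sum>i<n. inv_qfact q (n - Suc i) * inv_qfact q (n + Suc i) * ?t (n - Suc i))"
    by (subst sum.nat_diff_reindex[symmetric], rule sum.cong) (auto simp: mult_2)
  also have "\<dots> = K * ?B"
    unfolding sum_distrib_left by (rule sum.cong[OF refl], subst t2) (simp_all only: lessThan_iff mult_ac)
  also have "(\<Sum>k\<in>{n..2 * n}. inv_qfact q k * inv_qfact q (2 * n - k) * ?t k)
      = (\<Sum>r<Suc n. inv_qfact q (n + r) * inv_qfact q (n - r) * ?t (n + r))"
    by (rule sum.reindex_bij_witness[of _ "\<lambda>r. n + r" "\<lambda>k. k - n"]) (auto simp: mult_2)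
  also have "\<dots> = K * ?A"
    unfolding sum_distrib_left t1 by (rule sum.cong[OF refl]) (simp only: mult_ac)
  also have "qpoch z q (2 * n) = K * (qpoch x q n * qpoch y q n)"
    using qpoch_add[of z q n n, folded mult_2] qpoch_div_power[OF assms(3,2), of n] assms(2)
    by (simp add: z_def K_def mult_ac)
  finally have "K * (?A + ?B) = K * (inv_qfact q (2 * n) * qpoch x q n * qpoch y q n)"
    by (simp add: algebra_simps)
  then show ?thesis using K0 by simp
qed

lemma jacobi_triple_product:
  fixes q x y :: complex
  assumes "norm q < 1" "q \<noteq> 0" "x * y = q"
  shows "(\<Sum>r. (-1) ^ r * q ^ (r choose 2) * x ^ r) + (\<Sum>i. (-1) ^ Suc i * q ^ (Suc i choose 2) * y ^ Suc i)
       = qpoch_inf x q * qpoch_inf y q * qpoch_inf q q"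
proof -
  let ?f = "\<lambda>x r. (-1) ^ r * q ^ (r choose 2) * x ^ r"
  let ?E = "1 / qpoch_inf q q"
  have sf: "summable (\<lambda>r. norm (?f u r))" for u
    using summable_gaussian[OF assms(1), of u] by (simp add: norm_mult norm_power)
  have "(\<lambda>n. (\<Sum>r. ?f x r * (inv_qfact_diff q n (r + 0) * inv_qfact q (n + (r + 0))))
          + (\<Sum>i. ?f y (Suc i) * (inv_qfact_diff q n (i + 1) * inv_qfact q (n + (i + 1)))))
      \<longlonglongrightarrow> (\<Sum>r. ?f x r) * (?E * ?E) + (\<Sum>i. ?f y (Suc i)) * (?E * ?E)"
    using sf[of x] sf[of y, THEN summable_Suc_iff[THEN iffD2]]
    by (intro tendsto_add suminf_inv_qfact_diff_sum_LIMSEQ assms)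
  moreover have "(\<Sum>r. ?f x r * (inv_qfact_diff q n (r + 0) * inv_qfact q (n + (r + 0))))
          + (\<Sum>i. ?f y (Suc i) * (inv_qfact_diff q n (i + 1) * inv_qfact q (n + (i + 1))))
        = inv_qfact q (2 * n) * qpoch x q n * qpoch y q n" for n
    unfolding suminf_inv_qfact_diff finite_jacobi_triple_product[OF assms, of n, symmetric] by simp
  moreover have "(\<lambda>n. inv_qfact q (2 * n) * qpoch x q n * qpoch y q n) \<longlonglongrightarrow> ?E * qpoch_inf x q * qpoch_inf y q"
    using LIMSEQ_subseq_LIMSEQ[OF inv_qfact_LIMSEQ[OF assms(1)], of "\<lambda>n. 2 * n"]
    by (intro tendsto_mult qpoch_LIMSEQ assms) (auto simp: strict_mono_def o_def)
  ultimately have "(\<Sum>r. ?f x r) * (?E * ?E) + (\<Sum>i. ?f y (Suc i)) * (?E * ?E)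
      = ?E * qpoch_inf x q * qpoch_inf y q"
    by (simp only: LIMSEQ_unique)
  then show ?thesis using qpoch_inf_nonzero[OF assms(1) assms(1)] by (simp add: divide_simps)
qed

section \<open>The Rogers-Ramanujan identities\<close>

definition rogers_series :: "complex \<Rightarrow> complex \<Rightarrow> complex" where
  "rogers_series q x = (\<Sum>k. q ^ (k * k) * x ^ k * inv_qfact q k)"

lemma summable_rogers_majorant:
  fixes q x :: complex
  assumes "norm q < 1"
  shows "summable (\<lambda>k. norm (q ^ (k * k) * x ^ k))"
proof (rule summable_comparison_test'[OF summable_gaussian[OF assms, of "q * x"]])
  fix k
  have "norm (q ^ (k * k) * x ^ k) = norm (q ^ (k choose 2)) * norm (q ^ (k choose 2) * (q * x) ^ k)"
    unfolding square_eq_choose_two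
    by (simp add: power_add mult_2 norm_mult power_mult_distrib)
  also have "\<dots> \<le> 1 * norm (q ^ (k choose 2) * (q * x) ^ k)"
    using assms by (intro mult_right_mono) (auto simp: norm_power power_le_one)
  finally show "norm (norm (q ^ (k * k) * x ^ k)) \<le> norm (q ^ (k choose 2) * (q * x) ^ k)" by simp
qed

lemma summable_rogers_series:
  assumes "norm q < 1"
  shows "summable (\<lambda>k. norm (q ^ (k * k) * x ^ k * inv_qfact q k))"
proof -
  obtain C where C: "C > 0" "\<And>n. norm (inv_qfact q n) \<le> C" using inv_qfact_bounded[OF assms] by blast
  show ?thesis
  proof (rule summable_comparison_test'[OF summable_mult2[OF summable_rogers_majorant[OF assms, of x], of C]])
    show "norm (norm (q ^ (k * k) * x ^ k * inv_qfact q k)) \<le> norm (q ^ (k * k) * x ^ k) * C" for k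
      using mult_left_mono[OF C(2), of "norm (q ^ (k * k) * x ^ k)" k] by (simp add: norm_mult)
  qed
qed

text \<open>The limit of \<open>bailey_lemma_twice\<close>: on the left one reciprocal q-factorial tends to
\<open>1 / (q;q)\<^sub>\<infinity>\<close>, on the right two of them do, so one factor remains.\<close>

lemma rogers_series_eq_theta:
  assumes "norm q < 1"
    and unit: "\<And>n. (\<Sum>r\<le>n. \<alpha> r * inv_qfact q (n - r) * inv_qfact q (n + r + c)) = (if n = 0 then 1 else 0)"
    and \<alpha>: "summable (\<lambda>r. norm (\<alpha> r))"
  shows "rogers_series q (q ^ c)
       = (\<Sum>r. q ^ (r * (r + c)) * (q ^ (r * (r + c)) * \<alpha> r)) / qpoch_inf q q"
proof -
  let ?E = "1 / qpoch_inf q q"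
  let ?f = "\<lambda>s. q ^ (s * s) * (q ^ c) ^ s * inv_qfact q s"
  let ?g = "\<lambda>r. q ^ (r * (r + c)) * (q ^ (r * (r + c)) * \<alpha> r)"
  have "summable (\<lambda>r. norm (?g r))"
  proof (rule summable_comparison_test'[OF \<alpha>])
    fix r
    have "norm (?g r) \<le> 1 * (1 * norm (\<alpha> r))"
      unfolding norm_mult norm_power using assms(1)
      by (intro mult_mono power_le_one mult_nonneg_nonneg) auto
    then show "norm (norm (?g r)) \<le> norm (\<alpha> r)" by simp
  qed
  then have "(\<lambda>N. \<Sum>r. ?g r * (inv_qfact_diff q N (r + 0) * inv_qfact q (N + (r + c))))
      \<longlonglongrightarrow> (\<Sum>r. ?g r) * (?E * ?E)"
    by (rule suminf_inv_qfact_diff_sum_LIMSEQ[OF assms(1)])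
  moreover have "(\<lambda>N. \<Sum>s. ?f s * inv_qfact_diff q N s) \<longlonglongrightarrow> (\<Sum>s. ?f s) * ?E"
    by (intro suminf_inv_qfact_diff_LIMSEQ summable_rogers_series assms)
  moreover have "(\<Sum>s. ?f s * inv_qfact_diff q N s)
      = (\<Sum>r. ?g r * (inv_qfact_diff q N (r + 0) * inv_qfact q (N + (r + c))))" for N
  proof -
    have "(\<Sum>s. ?f s * inv_qfact_diff q N s) = (\<Sum>s\<le>N. q ^ (s * (s + c)) * inv_qfact q s * inv_qfact q (N - s))"
      using suminf_inv_qfact_diff[of ?f q N 0 "\<lambda>_. 1"]
      by (simp add: lessThan_Suc_atMost power_add distrib_left power_mult mult_ac flip: power_mult)
    also have "\<dots> = (\<Sum>r\<le>N. ?g r * inv_qfact q (N - r) * inv_qfact q (N + r + c))"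
      by (rule bailey_lemma_twice[OF assms(1) unit])
    also have "\<dots> = (\<Sum>r. ?g r * (inv_qfact_diff q N (r + 0) * inv_qfact q (N + (r + c))))"
      unfolding suminf_inv_qfact_diff by (simp add: lessThan_Suc_atMost mult_ac add_ac)
    finally show ?thesis .
  qed
  ultimately have "(\<Sum>r. ?g r) * (?E * ?E) = (\<Sum>s. ?f s) * ?E"
    by (simp only: LIMSEQ_unique)
  then show ?thesis using qpoch_inf_nonzero[OF assms(1) assms(1)]
    by (simp add: rogers_series_def divide_simps)
qed

lemma qpoch_five_dissection:
  "qpoch q q (5 * n) = qpoch q (q ^ 5) n * qpoch (q ^ 2) (q ^ 5) n * qpoch (q ^ 3) (q ^ 5) n
      * qpoch (q ^ 4) (q ^ 5) n * qpoch (q ^ 5) (q ^ 5) n"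
proof (induction n)
  case (Suc n)
  have "5 * Suc n = Suc (Suc (Suc (Suc (Suc (5 * n)))))" by simp
  then have five: "qpoch q q (5 * Suc n) = qpoch q q (5 * n) * (1 - q * (q ^ 5) ^ n) * (1 - q ^ 2 * (q ^ 5) ^ n)
      * (1 - q ^ 3 * (q ^ 5) ^ n) * (1 - q ^ 4 * (q ^ 5) ^ n) * (1 - q ^ 5 * (q ^ 5) ^ n)"
    by (simp only: qpoch_Suc power_Suc power_mult) (simp add: eval_nat_numeral mult_ac)
  show ?case unfolding five Suc.IH qpoch_Suc by (simp only: mult_ac)
qed simp

lemma qpoch_inf_five_dissection:
  assumes "norm q < 1"
  shows "qpoch_inf q q = qpoch_inf q (q ^ 5) * qpoch_inf (q ^ 2) (q ^ 5) * qpoch_inf (q ^ 3) (q ^ 5)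
      * qpoch_inf (q ^ 4) (q ^ 5) * qpoch_inf (q ^ 5) (q ^ 5)"
proof (rule LIMSEQ_unique)
  show "(\<lambda>n. qpoch q q (5 * n)) \<longlonglongrightarrow> qpoch_inf q q"
    using LIMSEQ_subseq_LIMSEQ[OF qpoch_LIMSEQ[OF assms], of "\<lambda>n. 5 * n"]
    by (simp add: strict_mono_def o_def)
  show "(\<lambda>n. qpoch q q (5 * n)) \<longlonglongrightarrow> qpoch_inf q (q ^ 5) * qpoch_inf (q ^ 2) (q ^ 5)
      * qpoch_inf (q ^ 3) (q ^ 5) * qpoch_inf (q ^ 4) (q ^ 5) * qpoch_inf (q ^ 5) (q ^ 5)"
    unfolding qpoch_five_dissection
    by (intro tendsto_mult qpoch_LIMSEQ norm_power_less_one assms) auto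
qed

text \<open>After two applications of Bailey's lemma the unit pairs acquire the factor
\<open>q ^ (2 r (r + c))\<close>, and since \<open>2 r\<^sup>2 = 4 (r choose 2) + 2 r\<close> the exponent
\<open>r choose 2\<close> becomes \<open>5 (r choose 2)\<close> plus a linear term. The series are therefore theta series in base
\<open>Q = q\<^sup>5\<close>, with arguments \<open>q\<^sup>2, q\<^sup>3\<close> for \<open>c = 0\<close> and \<open>q\<^sup>4, q\<close> for \<open>c = 1\<close>. The triple product
cancels against three of the five residue classes of factors in \<open>(q;q)\<^sub>\<infinity>\<close>.\<close>

lemma
  assumes "norm q < 1" "q \<noteq> 0"
  shows rogers_ramanujan_first: "rogers_series q 1 = 1 / qpochs_inf [q, q ^ 4] (q ^ 5)"
    and rogers_ramanujan_second: "rogers_series q q = 1 / qpochs_inf [q ^ 2, q ^ 3] (q ^ 5)"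
proof -
  define Q where "Q = q ^ 5"
  have Q: "norm Q < 1" "Q \<noteq> 0" using norm_power_less_one[OF assms(1), of 5] assms(2) by (auto simp: Q_def)
  define \<theta> where "\<theta> x r = (-1) ^ r * Q ^ (r choose 2) * x ^ r" for x :: complex and r
  have s\<theta>: "summable (\<theta> x)" for x
    using summable_norm_cancel[OF summable_gaussian[OF Q(1), of "- x"]]
    by (simp add: \<theta>_def [abs_def] power_minus[of x] mult_ac)
  have jtp: "(\<Sum>r. \<theta> x r) + (\<Sum>i. \<theta> y (Suc i)) = qpoch_inf x Q * qpoch_inf y Q * qpoch_inf Q Q"
    if "x * y = Q" for x y
    unfolding \<theta>_def by (rule jacobi_triple_product[OF Q that])
  have s2: "summable (\<lambda>r. norm (a r * ((-1) ^ r * q ^ (r choose 2))))"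
    if "\<And>r. norm (a r) \<le> 2" for a :: "nat \<Rightarrow> complex"
  proof (rule summable_comparison_test'[OF summable_mult[OF summable_gaussian[OF assms(1), of 1], of 2]])
    show "norm (norm (a r * ((-1) ^ r * q ^ (r choose 2)))) \<le> 2 * norm (q ^ (r choose 2) * 1 ^ r)" for r
      using mult_right_mono[OF that, of "norm (q ^ (r choose 2))" r] by (simp add: norm_mult norm_power)
  qed
  have le1: "norm (q ^ n) \<le> 1" for n using assms(1) by (simp add: norm_power power_le_one)
  have nz: "qpoch_inf (q ^ n) Q \<noteq> 0" if "0 < n" for n
    using that by (intro qpoch_inf_nonzero norm_power_less_one Q assms)
  have pow: "q ^ (r * r) = q ^ (2 * (r choose 2) + r)" for r by (simp only: square_eq_choose_two)

  have "norm (1 + (if r = 0 then 0 else q ^ r)) \<le> 2" for r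
    using norm_triangle_ineq[of 1 "q ^ r"] le1[of r] by auto
  then have "rogers_series q (q ^ 0)
      = (\<Sum>r. q ^ (r * (r + 0)) * (q ^ (r * (r + 0)) * ((1 + (if r = 0 then 0 else q ^ r))
             * ((-1) ^ r * q ^ (r choose 2))))) / qpoch_inf q q"
    by (intro rogers_series_eq_theta assms unit_bailey_pair_one s2)
  also have "(\<lambda>r. q ^ (r * (r + 0)) * (q ^ (r * (r + 0)) * ((1 + (if r = 0 then 0 else q ^ r))
             * ((-1) ^ r * q ^ (r choose 2))))) = (\<lambda>r. \<theta> (q ^ 2) r + (if r = 0 then 0 else \<theta> (q ^ 3) r))"
  proof
    fix r
    have "q ^ (r * r) * (q ^ (r * r) * ((-1) ^ r * q ^ (r choose 2))) = \<theta> (q ^ 2) r"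
      unfolding pow \<theta>_def Q_def power_mult[symmetric] by (simp add: algebra_simps flip: power_add)
    moreover have "\<theta> (q ^ 2) r * q ^ r = \<theta> (q ^ 3) r"
      unfolding \<theta>_def power_mult[symmetric] by (simp add: mult_ac flip: power_add)
    ultimately show "q ^ (r * (r + 0)) * (q ^ (r * (r + 0)) * ((1 + (if r = 0 then 0 else q ^ r))
             * ((-1) ^ r * q ^ (r choose 2)))) = \<theta> (q ^ 2) r + (if r = 0 then 0 else \<theta> (q ^ 3) r)"
      by (simp add: algebra_simps)
  qed
  also have "(\<Sum>r. \<theta> (q ^ 2) r + (if r = 0 then 0 else \<theta> (q ^ 3) r))
      = (\<Sum>r. \<theta> (q ^ 2) r) + (\<Sum>i. \<theta> (q ^ 3) (Suc i))"
  proof -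
    let ?g = "\<lambda>r. if r = 0 then 0 else \<theta> (q ^ 3) r"
    have "summable (\<lambda>i. ?g (Suc i))" using s\<theta>[of "q ^ 3"] by (simp add: summable_Suc_iff)
    then have g: "summable ?g" by (rule summable_Suc_iff[THEN iffD1])
    show ?thesis
      using suminf_add[OF s\<theta>[of "q ^ 2"] g] suminf_split_head[OF g] by simp
  qed
  also have "\<dots> = qpoch_inf (q ^ 2) Q * qpoch_inf (q ^ 3) Q * qpoch_inf Q Q"
    by (rule jtp) (simp add: Q_def flip: power_add)
  finally show "rogers_series q 1 = 1 / qpochs_inf [q, q ^ 4] (q ^ 5)"
    using nz[of 1] nz[of 2] nz[of 3] nz[of 4] nz[of 5]
    unfolding qpoch_inf_five_dissection[OF assms(1)] Q_def qpochs_inf_def by (simp add: divide_simps)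

  have "norm (1 - q ^ (2 * r + 1)) \<le> 2" for r
    using norm_triangle_ineq4[of 1 "q ^ (2 * r + 1)"] le1[of "2 * r + 1"] by auto
  then have "rogers_series q (q ^ 1)
      = (\<Sum>r. q ^ (r * (r + 1)) * (q ^ (r * (r + 1)) * ((1 - q ^ (2 * r + 1))
             * ((-1) ^ r * q ^ (r choose 2))))) / qpoch_inf q q"
    by (intro rogers_series_eq_theta assms unit_bailey_pair_q s2)
  also have "(\<lambda>r. q ^ (r * (r + 1)) * (q ^ (r * (r + 1)) * ((1 - q ^ (2 * r + 1))
             * ((-1) ^ r * q ^ (r choose 2))))) = (\<lambda>r. \<theta> (q ^ 4) r + \<theta> q (Suc r))"
  proof
    fix r
    have "q ^ (r * (r + 1)) * (q ^ (r * (r + 1)) * ((-1) ^ r * q ^ (r choose 2))) = \<theta> (q ^ 4) r"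
      unfolding distrib_left power_add pow \<theta>_def Q_def power_mult[symmetric]
      by (simp add: algebra_simps flip: power_add)
    moreover have "\<theta> (q ^ 4) r * q ^ (2 * r + 1) = - \<theta> q (Suc r)"
      unfolding \<theta>_def Q_def power_mult[symmetric] choose_two_Suc
      by (simp add: algebra_simps flip: power_add)
    moreover have "p * (p * ((1 - w) * a)) = p * (p * a) - p * (p * a) * w" for p w a :: complex
      by (simp add: algebra_simps)
    ultimately show "q ^ (r * (r + 1)) * (q ^ (r * (r + 1)) * ((1 - q ^ (2 * r + 1))
             * ((-1) ^ r * q ^ (r choose 2)))) = \<theta> (q ^ 4) r + \<theta> q (Suc r)"
      by (simp only: diff_minus_eq_add)
  qed
  also have "(\<Sum>r. \<theta> (q ^ 4) r + \<theta> q (Suc r)) = (\<Sum>r. \<theta> (q ^ 4) r) + (\<Sum>r. \<theta> q (Suc r))"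
    using s\<theta> by (intro suminf_add[symmetric]) (auto simp: summable_Suc_iff)
  also have "\<dots> = qpoch_inf (q ^ 4) Q * qpoch_inf q Q * qpoch_inf Q Q"
    by (rule jtp) (simp add: Q_def eval_nat_numeral)
  finally show "rogers_series q q = 1 / qpochs_inf [q ^ 2, q ^ 3] (q ^ 5)"
    using nz[of 1] nz[of 2] nz[of 3] nz[of 4] nz[of 5]
    unfolding qpoch_inf_five_dissection[OF assms(1)] Q_def qpochs_inf_def by (simp add: divide_simps)
qed

section \<open>The Schur polynomials\<close>

text \<open>With upper index \<open>n - 1\<close> the q-Pascal rule holds for all integer arguments except
\<open>n = k = 0\<close>, where the left side is \<open>1\<close> and the right side \<open>0\<close>.\<close>

lemma gauss_binom_pascal:
  assumes "norm q < 1" "n \<noteq> 0 \<or> k \<noteq> 0"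
  shows "gauss_binom q n k = gauss_binom q (n - 1) k + q ^ nat (n - k) * gauss_binom q (n - 1) (k - 1)"
proof (cases "0 < k \<and> k < n")
  case True
  define i j where "i = nat (k - 1)" and "j = nat (n - k - 1)"
  have ij: "k = int (Suc i)" "n = int (Suc (Suc (i + j)))" using True by (auto simp: i_def j_def)
  have nz: "qpoch q q i \<noteq> 0" "qpoch q q j \<noteq> 0" "1 - q ^ Suc i \<noteq> 0" "1 - q ^ Suc j \<noteq> 0"
    using qpoch_q_nonzero[OF assms(1)] one_minus_power_nonzero[OF assms(1)] by blast+
  have nats: "nat n = Suc (Suc (i + j))" "nat k = Suc i" "nat (n - k) = Suc j"
    "nat (n - 1) = Suc (i + j)" "nat (n - 1 - k) = j" "nat (k - 1) = i" "nat (n - 1 - (k - 1)) = Suc j"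
    unfolding ij by auto
  have bounds: "0 \<le> k \<and> k \<le> n" "0 \<le> k \<and> k \<le> n - 1" "0 \<le> k - 1 \<and> k - 1 \<le> n - 1" using True by auto
  have S: "qpoch q q (Suc m) = qpoch q q m * (1 - q ^ Suc m)" for m by (simp add: qpoch_Suc)
  have "(1 - q ^ Suc (Suc (i + j))) = (1 - q ^ Suc j) + q ^ Suc j * (1 - q ^ Suc i)"
    by (simp add: power_add algebra_simps)
  then have "qpoch q q (Suc (Suc (i + j)))
      = qpoch q q (Suc (i + j)) * ((1 - q ^ Suc j) + q ^ Suc j * (1 - q ^ Suc i))"
    by (simp only: S[of "Suc (i + j)"])
  then show ?thesis
    unfolding gauss_binom_def nats if_P[OF bounds(1)] if_P[OF bounds(2)] if_P[OF bounds(3)]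
      S[of i] S[of j] using nz
    by (simp add: divide_simps del: power_Suc) (simp add: algebra_simps)
next
  case False
  then consider "k < 0" | "k > n" | "k = 0" "n > 0" | "k = n" "n > 0" using assms(2) by linarith
  then show ?thesis
    using qpoch_q_nonzero[OF assms(1)] by cases (auto simp: gauss_binom_def)
qed

text \<open>Both families of Schur polynomials at once: \<open>c = 1\<close> is the first family (apart from the
conventional value at \<open>m = 0\<close>), \<open>c = 0\<close> the second.\<close>

definition schur_series :: "nat \<Rightarrow> nat \<Rightarrow> complex \<Rightarrow> complex" where
  "schur_series c m q = (\<Sum>j. q ^ (j\<^sup>2 + c * j) * gauss_binom q (int m - int j - 1 - int c) (int j))"

lemma schur_b_eq_schur_series: "schur_b m q = schur_series 0 m q"
  by (simp add: schur_b_def schur_series_def)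

lemma schur_a_eq_schur_series: "0 < m \<Longrightarrow> schur_a m q = schur_series 1 m q"
  by (simp add: schur_a_def schur_series_def)

lemma schur_series_eq_sum:
  assumes "m \<le> K"
  shows "schur_series c m q = (\<Sum>j\<le>K. q ^ (j\<^sup>2 + c * j) * gauss_binom q (int m - int j - 1 - int c) (int j))"
  unfolding schur_series_def using assms by (intro suminf_finite) (auto simp: gauss_binom_def)

text \<open>Apply the q-Pascal rule to every term and shift the index in the second half. The
hypothesis \<open>c < m + 1\<close> excludes its exception, which for \<open>c = 1\<close> is met at \<open>m = 0\<close>.\<close>

lemma schur_series_rec:
  assumes "norm q < 1" "c < m + 1"
  shows "schur_series c (m + 2) q = schur_series c (m + 1) q + q ^ m * schur_series c m q"
proof -
  let ?g = "\<lambda>m j. gauss_binom q (int m - int j - 1 - int c) (int j)"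
  let ?u = "\<lambda>j. q ^ (j\<^sup>2 + c * j) * (q ^ nat (int m + 1 - int c - 2 * int j)
              * gauss_binom q (int m - int j - int c) (int j - 1))"
  have "schur_series c (m + 2) q = (\<Sum>j\<le>Suc (Suc m). q ^ (j\<^sup>2 + c * j) * ?g (m + 2) j)"
    by (rule schur_series_eq_sum) simp
  also have "\<dots> = (\<Sum>j\<le>Suc (Suc m). q ^ (j\<^sup>2 + c * j) * ?g (m + 1) j + ?u j)"
  proof (rule sum.cong[OF refl])
    fix j
    have "?g (m + 2) j = ?g (m + 1) j + q ^ nat (int m + 1 - int c - 2 * int j)
              * gauss_binom q (int m - int j - int c) (int j - 1)"
      using gauss_binom_pascal[OF assms(1), of "int (m + 2) - int j - 1 - int c" "int j"] assms(2)
      by (auto simp: algebra_simps)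
    then show "q ^ (j\<^sup>2 + c * j) * ?g (m + 2) j = q ^ (j\<^sup>2 + c * j) * ?g (m + 1) j + ?u j"
      by (simp only: distrib_left)
  qed
  also have "\<dots> = schur_series c (m + 1) q + (\<Sum>j\<le>Suc (Suc m). ?u j)"
    unfolding sum.distrib by (subst schur_series_eq_sum[of "m + 1" "Suc (Suc m)"]) simp_all
  also have "(\<Sum>j\<le>Suc (Suc m). ?u j) = (\<Sum>i\<le>Suc m. ?u (Suc i))"
    by (subst sum.atMost_Suc_shift) (simp add: gauss_binom_def)
  also have "\<dots> = (\<Sum>i\<le>Suc m. q ^ m * (q ^ (i\<^sup>2 + c * i) * ?g m i))"
  proof (rule sum.cong[OF refl])
    fix i
    show "?u (Suc i) = q ^ m * (q ^ (i\<^sup>2 + c * i) * ?g m i)"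
    proof (cases "int i \<le> int m - int i - 1 - int c")
      case True
      then have "(Suc i)\<^sup>2 + c * Suc i + nat (int m + 1 - int c - 2 * int (Suc i)) = m + (i\<^sup>2 + c * i)"
        by (simp add: power2_eq_square algebra_simps nat_diff_distrib)
      then have "q ^ ((Suc i)\<^sup>2 + c * Suc i) * q ^ nat (int m + 1 - int c - 2 * int (Suc i)) = q ^ m * q ^ (i\<^sup>2 + c * i)"
        by (simp only: flip: power_add)
      moreover have "gauss_binom q (int m - int (Suc i) - int c) (int (Suc i) - 1) = ?g m i"
        by (simp add: algebra_simps)
      ultimately show ?thesis by (simp only: mult.assoc[symmetric])
    qed (simp add: gauss_binom_def)
  qed
  also have "\<dots> = q ^ m * schur_series c m q"
    unfolding schur_series_eq_sum[of m "Suc m", OF le_SucI[OF order_refl]]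
    by (rule sum_distrib_left[symmetric])
  finally show ?thesis .
qed

lemma schur_b_rec:
  assumes "norm q < 1"
  shows "schur_b (m + 2) q = schur_b (m + 1) q + q ^ m * schur_b m q"
  using schur_series_rec[OF assms, of 0 m] by (simp add: schur_b_eq_schur_series)

text \<open>At \<open>m = 0\<close> the recurrence depends on the conventional value \<open>a\<^sub>0 = 1\<close>.\<close>

lemma schur_a_rec:
  assumes "norm q < 1"
  shows "schur_a (m + 2) q = schur_a (m + 1) q + q ^ m * schur_a m q"
proof (cases "m = 0")
  case True
  have "schur_a 2 q = (\<Sum>j\<le>2. q ^ (j\<^sup>2 + 1 * j) * gauss_binom q (int 2 - int j - 1 - int 1) (int j))"
    by (subst schur_a_eq_schur_series, simp, rule schur_series_eq_sum, simp)
  also have "\<dots> = 1"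
    by (simp add: gauss_binom_def eval_nat_numeral)
  finally show ?thesis using True schur_initial_values by (simp add: numeral_2_eq_2)
next
  case False
  then show ?thesis using schur_series_rec[OF assms, of 1 m] by (simp add: schur_a_eq_schur_series)
qed

text \<open>The larger of two consecutive absolute values grows in one step by at most the factor
\<open>1 + \<bar>q\<bar> ^ m \<le> exp (\<bar>q\<bar> ^ m)\<close>, and the product of these factors converges.\<close>

lemma schur_recurrence_bounded:
  fixes q :: complex
  assumes "norm q < 1" and rec: "\<And>m. u (m + 2) = u (m + 1) + q ^ m * u m"
  obtains B where "\<And>m. norm (u m) \<le> B"
proof -
  \<comment> \<open>Controlling two consecutive values turns the recurrence into one of first order.\<close>
  define w where "w m = max (norm (u m)) (norm (u (Suc m)))" for m
  have w0: "0 \<le> w m" for m by (simp add: w_def le_max_iff_disj)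
  have w_step: "w (Suc m) \<le> exp (norm q ^ m) * w m" for m
  proof -
    have "norm (u (Suc m)) \<le> w m" "norm (u m) \<le> w m" by (auto simp: w_def)
    moreover from this have "norm (u (Suc (Suc m))) \<le> w m + norm q ^ m * w m"
      using rec[of m] norm_triangle_ineq[of "u (Suc m)" "q ^ m * u m"]
        mult_left_mono[of "norm (u m)" "w m" "norm q ^ m"]
      by (simp add: norm_mult norm_power)
    ultimately have "w (Suc m) \<le> (1 + norm q ^ m) * w m"
      using w0[of m] by (simp add: w_def[of "Suc m"] algebra_simps add_increasing2)
    also have "\<dots> \<le> exp (norm q ^ m) * w m"
      using w0 by (intro mult_right_mono) (auto simp: exp_ge_add_one_self)
    finally show ?thesis .
  qed
  have "w m \<le> exp (\<Sum>k<m. norm q ^ k) * w 0" for m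
  proof (induction m)
    case (Suc m)
    have "exp (norm q ^ m) * w m \<le> exp (norm q ^ m) * (exp (\<Sum>k<m. norm q ^ k) * w 0)"
      using Suc.IH by (intro mult_left_mono) auto
    also have "\<dots> = exp (\<Sum>k<Suc m. norm q ^ k) * w 0" by (simp add: exp_add)
    finally show ?case using w_step[of m] by (rule order_trans[rotated])
  qed simp
  moreover have "exp (\<Sum>k<m. norm q ^ k) * w 0 \<le> exp (\<Sum>k. norm q ^ k) * w 0" for m
    using assms(1) w0 by (intro mult_right_mono) (auto intro!: sum_le_suminf summable_geometric)
  moreover have "norm (u m) \<le> w m" for m by (simp add: w_def)
  ultimately have "norm (u m) \<le> exp (\<Sum>k. norm q ^ k) * w 0" for m
    by (blast intro: order_trans)
  then show ?thesis by (rule that)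
qed

section \<open>Schur polynomials and the Rogers series\<close>

lemma rogers_series_functional_eq:
  assumes "norm q < 1"
  shows "rogers_series q x = rogers_series q (q * x) + q * x * rogers_series q (q ^ 2 * x)"
proof -
  let ?t = "\<lambda>x k. q ^ (k * k) * x ^ k * inv_qfact q k"
  let ?d = "\<lambda>k. ?t x k - ?t (q * x) k"
  have s: "summable (?t x)" for x using summable_norm_cancel[OF summable_rogers_series[OF assms]] .
  have sd: "summable ?d" by (intro summable_diff s)
  have d: "?d (Suc k) = q * x * ?t (q ^ 2 * x) k" for k
  proof -
    have "?d (Suc k) = q ^ (Suc k * Suc k) * x ^ Suc k * ((1 - q ^ Suc k) * inv_qfact q (Suc k))"
      by (simp add: power_mult_distrib algebra_simps)
    also have "\<dots> = q * x * ?t (q ^ 2 * x) k"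
      unfolding inv_qfact_Suc[OF assms]
      by (simp add: power_mult_distrib power_add mult_ac flip: power_mult) (simp add: mult_2 mult_2_right power_add mult_ac)
    finally show ?thesis .
  qed
  have "rogers_series q x - rogers_series q (q * x) = suminf ?d"
    unfolding rogers_series_def by (intro suminf_diff s)
  also have "\<dots> = (\<Sum>k. ?d (Suc k))" using suminf_split_head[OF sd] by simp
  also have "\<dots> = q * x * rogers_series q (q ^ 2 * x)"
    unfolding d rogers_series_def by (rule suminf_mult[OF s])
  finally show ?thesis by (simp add: algebra_simps)
qed

text \<open>Both sides satisfy the recurrence of the Schur polynomials and agree for \<open>m = 0\<close> and
\<open>m = 1\<close>, where \<open>a\<^sub>0 = b\<^sub>1 = 1\<close> and \<open>a\<^sub>1 = b\<^sub>0 = 0\<close>.\<close>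

lemma schur_rogers_combination:
  assumes "norm q < 1"
  shows "schur_a m q * rogers_series q 1 - schur_b m q * rogers_series q q
       = (-1) ^ m * q ^ (m choose 2) * rogers_series q (q ^ m)"
proof -
  have "(schur_a m q * rogers_series q 1 - schur_b m q * rogers_series q q
       = (-1) ^ m * q ^ (m choose 2) * rogers_series q (q ^ m)) \<and>
     (schur_a (m + 1) q * rogers_series q 1 - schur_b (m + 1) q * rogers_series q q
       = (-1) ^ (m + 1) * q ^ (m + 1 choose 2) * rogers_series q (q ^ (m + 1)))"
  proof (induction m)
    case 0
    then show ?case using schur_initial_values by (simp add: numeral_2_eq_2)
  next
    case (Suc m)
    define D where "D m = (-1) ^ m * q ^ (m choose 2) * rogers_series q (q ^ m)" for m
    define L where "L m = schur_a m q * rogers_series q 1 - schur_b m q * rogers_series q q" for m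
    have "D (m + 2) = D (m + 1) + q ^ m * D m"
      using rogers_series_functional_eq[OF assms, of "q ^ m"]
      by (simp add: D_def choose_two_Suc power_add power2_eq_square algebra_simps)
    moreover have "L (m + 2) = L (m + 1) + q ^ m * L m"
      unfolding L_def schur_a_rec[OF assms] schur_b_rec[OF assms] by (simp add: algebra_simps)
    ultimately have "schur_a (m + 2) q * rogers_series q 1 - schur_b (m + 2) q * rogers_series q q = D (m + 2)"
      using Suc.IH unfolding D_def[symmetric] L_def[symmetric] by simp
    then show ?case using Suc.IH by (simp add: D_def)
  qed
  then show ?thesis by blast
qed

lemma rogers_series_norm_le:
  assumes "norm q < 1" "norm y \<le> norm x"
  shows "norm (rogers_series q y) \<le> (\<Sum>k. norm (q ^ (k * k) * x ^ k * inv_qfact q k))"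
  unfolding rogers_series_def
proof (rule order_trans[OF summable_norm suminf_le])
  show "norm (q ^ (k * k) * y ^ k * inv_qfact q k) \<le> norm (q ^ (k * k) * x ^ k * inv_qfact q k)" for k
    unfolding norm_mult norm_power using assms by (intro mult_mono power_mono) auto
qed (intro summable_rogers_series assms)+

lemma rogers_series_LIMSEQ:
  assumes "norm q < 1"
  shows "(\<lambda>n. rogers_series q (x * q ^ n)) \<longlonglongrightarrow> 1"
proof -
  let ?t = "\<lambda>x k. q ^ (k * k) * x ^ k * inv_qfact q k"
  have "(\<lambda>n. \<Sum>k. ?t (x * q ^ n) k) \<longlonglongrightarrow> (\<Sum>k. ?t 0 k)"
  proof (rule tannery_sequentially[OF _ _ summable_rogers_series[OF assms, of x]])
    show "(\<lambda>n. ?t (x * q ^ n) k) \<longlonglongrightarrow> ?t 0 k" for k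
      using assms by (intro tendsto_intros tendsto_mult_right_zero LIMSEQ_power_zero)
    show "norm (?t (x * q ^ n) k) \<le> norm (?t x k)" for n k
      unfolding norm_mult norm_power using assms
      by (intro mult_right_mono mult_left_mono power_mono mult_left_le) (auto simp: power_le_one)
  qed
  moreover have "(\<Sum>k. ?t 0 k) = 1" using suminf_finite[of "{0}" "?t 0"] by simp
  ultimately show ?thesis by (simp add: rogers_series_def)
qed

section \<open>Summing the Rogers series over even shifts\<close>

definition shifted_rogers_term :: "complex \<Rightarrow> complex \<Rightarrow> nat \<Rightarrow> complex" where
  "shifted_rogers_term q x n =
     q ^ (2 * (n * n) + n) * x ^ (2 * n) * inv_qfact (q ^ 2) n * rogers_series q (x * q ^ (2 * n))"

lemma summable_shifted_rogers_sum_weight: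
  assumes "norm q < 1"
  shows "summable (\<lambda>n. norm (q ^ (2 * (n * n) + n) * x ^ (2 * n) * inv_qfact (q ^ 2) n))"
proof -
  have q2: "norm (q ^ 2) < 1" using norm_power_less_one[OF assms] by simp
  show ?thesis
  proof (rule summable_comparison_test'[OF summable_rogers_series[OF q2, of "x ^ 2"]])
    fix n
    have "norm (q ^ (2 * (n * n) + n) * x ^ (2 * n) * inv_qfact (q ^ 2) n)
        = norm (q ^ n) * norm ((q ^ 2) ^ (n * n) * (x ^ 2) ^ n * inv_qfact (q ^ 2) n)"
      unfolding norm_mult[symmetric] by (simp only: power_add power_mult[symmetric] mult_ac)
    also have "\<dots> \<le> 1 * norm ((q ^ 2) ^ (n * n) * (x ^ 2) ^ n * inv_qfact (q ^ 2) n)"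
      using assms by (intro mult_right_mono) (auto simp: norm_power power_le_one)
    finally show "norm (norm (q ^ (2 * (n * n) + n) * x ^ (2 * n) * inv_qfact (q ^ 2) n))
        \<le> norm ((q ^ 2) ^ (n * n) * (x ^ 2) ^ n * inv_qfact (q ^ 2) n)" by simp
  qed
qed

lemma shifted_rogers_term_norm_le:
  assumes "norm q < 1" "norm y \<le> norm x"
  shows "norm (shifted_rogers_term q y n)
      \<le> norm (q ^ (2 * (n * n) + n) * x ^ (2 * n) * inv_qfact (q ^ 2) n)
         * (\<Sum>k. norm (q ^ (k * k) * x ^ k * inv_qfact q k))"
proof -
  have "norm (y * q ^ (2 * n)) \<le> norm y * 1"
    unfolding norm_mult norm_power using assms(1) by (intro mult_left_mono power_le_one) auto
  then have "norm (rogers_series q (y * q ^ (2 * n))) \<le> (\<Sum>k. norm (q ^ (k * k) * x ^ k * inv_qfact q k))"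
    using assms by (intro rogers_series_norm_le) auto
  moreover have "norm (q ^ (2 * (n * n) + n) * y ^ (2 * n) * inv_qfact (q ^ 2) n)
      \<le> norm (q ^ (2 * (n * n) + n) * x ^ (2 * n) * inv_qfact (q ^ 2) n)"
    unfolding norm_mult norm_power using assms by (intro mult_mono power_mono) auto
  ultimately show ?thesis
    unfolding shifted_rogers_term_def norm_mult[of _ "rogers_series _ _"] by (intro mult_mono) auto
qed

lemma summable_shifted_rogers_sum:
  assumes "norm q < 1"
  shows "summable (shifted_rogers_term q x)"
  by (rule summable_comparison_test'[OF summable_mult2[OF summable_shifted_rogers_sum_weight[OF assms]]
        shifted_rogers_term_norm_le[OF assms order_refl]])

text \<open>Write \<open>w n\<close> for the coefficient of the series and \<open>g m = G(x q ^ m)\<close>, so that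
\<open>g m = g (m + 1) + q ^ (m + 1) x g (m + 2)\<close>. The difference of the \<open>n\<close>-th terms of the two sides is
\<open>P n - P (n + 1)\<close> with \<open>P n = w n (1 - q ^ (2 n)) g (2 n + 1)\<close>. This uses the recurrence of \<open>g\<close> twice:
at \<open>2 n\<close> for the left side, and at \<open>2 n + 1\<close> to lower the index in \<open>P (n + 1)\<close>. As \<open>P 0 = 0\<close> and \<open>P\<close> tends to
\<open>0\<close>, the sum of the differences is \<open>0\<close>.\<close>

lemma shifted_rogers_sum_functional_eq:
  assumes "norm q < 1"
  shows "(\<Sum>n. shifted_rogers_term q x n) = (1 + x * q) * (\<Sum>n. shifted_rogers_term q (x * q) n)"
proof -
  have q2: "norm (q ^ 2) < 1" using norm_power_less_one[OF assms] by simp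
  define w where "w n = q ^ (2 * (n * n) + n) * x ^ (2 * n) * inv_qfact (q ^ 2) n" for n
  define g where "g n = rogers_series q (x * q ^ n)" for n
  define P where "P n = w n * (1 - q ^ (2 * n)) * g (2 * n + 1)" for n
  have g_rec: "g n = g (n + 1) + q ^ (n + 1) * x * g (n + 2)" for n
    using rogers_series_functional_eq[OF assms, of "x * q ^ n"]
    by (simp add: g_def power2_eq_square mult_ac)
  have T: "shifted_rogers_term q x n = w n * g (2 * n)" for n
    by (simp add: shifted_rogers_term_def w_def g_def)
  have T': "shifted_rogers_term q (x * q) n = w n * q ^ (2 * n) * g (2 * n + 1)" for n
    by (simp add: shifted_rogers_term_def w_def g_def power_mult_distrib mult_ac)
  have w_step: "w (Suc n) * (1 - q ^ (2 * Suc n)) = w n * q ^ (4 * n + 3) * x ^ 2" for n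
  proof -
    have "w (Suc n) * (1 - q ^ (2 * Suc n))
        = q ^ (2 * (Suc n * Suc n) + Suc n) * x ^ (2 * Suc n) * ((1 - (q ^ 2) ^ Suc n) * inv_qfact (q ^ 2) (Suc n))"
      unfolding w_def power_mult[symmetric] by (simp only: mult_ac)
    also have "\<dots> = q ^ ((2 * (n * n) + n) + (4 * n + 3)) * x ^ (2 * n + 2) * inv_qfact (q ^ 2) n"
    proof -
      have "2 * (Suc n * Suc n) + Suc n = (2 * (n * n) + n) + (4 * n + 3)" by simp
      moreover have "2 * Suc n = 2 * n + 2" by simp
      ultimately show ?thesis unfolding inv_qfact_Suc[OF q2] by (simp only:)
    qed
    also have "\<dots> = w n * q ^ (4 * n + 3) * x ^ 2"
      unfolding w_def power_add[of q "2 * (n * n) + n"] power_add[of x] by (simp only: mult_ac)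
    finally show ?thesis .
  qed
  have tele: "shifted_rogers_term q x n - (1 + x * q) * shifted_rogers_term q (x * q) n = P n - P (Suc n)" for n
  proof -
    have "P (Suc n) = w n * q ^ (4 * n + 3) * x ^ 2 * g (2 * n + 3)"
      unfolding P_def w_step by (simp add: numeral_3_eq_3)
    also have "\<dots> = w n * q ^ (2 * n + 1) * x * (q ^ (2 * n + 2) * x * g (2 * n + 3))"
      by (simp add: power_add power2_eq_square mult_ac eval_nat_numeral mult_2)
    also have "q ^ (2 * n + 2) * x * g (2 * n + 3) = g (2 * n + 1) - g (2 * n + 2)"
      using g_rec[of "2 * n + 1"] by (simp add: eval_nat_numeral)
    finally show ?thesis
      unfolding T T' P_def g_rec[of "2 * n"] by (simp add: algebra_simps)
  qed
  have "P \<longlonglongrightarrow> 0"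
  proof (rule Lim_null_comparison)
    show "eventually (\<lambda>n. norm (P n) \<le> norm (w n) * (2 * (\<Sum>k. norm (q ^ (k * k) * x ^ k * inv_qfact q k)))) sequentially"
    proof (rule always_eventually, rule allI)
      fix n
      have "norm (x * q ^ (2 * n + 1)) \<le> norm x * 1"
        unfolding norm_mult norm_power using assms(1) by (intro mult_left_mono power_le_one) auto
      then have "norm (g (2 * n + 1)) \<le> (\<Sum>k. norm (q ^ (k * k) * x ^ k * inv_qfact q k))"
        unfolding g_def using assms by (intro rogers_series_norm_le) auto
      moreover have "norm (1 - q ^ (2 * n)) \<le> 2"
        using norm_triangle_ineq4[of 1 "q ^ (2 * n)"] power_le_one[of "norm q" "2 * n"] assms
        by (simp add: norm_power)
      ultimately show "norm (P n) \<le> norm (w n) * (2 * (\<Sum>k. norm (q ^ (k * k) * x ^ k * inv_qfact q k)))"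
        unfolding P_def norm_mult mult.assoc by (intro mult_left_mono mult_mono) auto
    qed
    show "(\<lambda>n. norm (w n) * (2 * (\<Sum>k. norm (q ^ (k * k) * x ^ k * inv_qfact q k)))) \<longlonglongrightarrow> 0"
      using summable_LIMSEQ_zero[OF summable_shifted_rogers_sum_weight[OF assms, of x]]
      unfolding w_def[symmetric] by (rule tendsto_mult_left_zero)
  qed
  then have "(\<lambda>n. P n - P (Suc n)) sums (P 0 - 0)" by (rule telescope_sums')
  then have "(\<Sum>n. shifted_rogers_term q x n - (1 + x * q) * shifted_rogers_term q (x * q) n) = 0"
    unfolding tele by (simp add: P_def sums_iff)
  then show ?thesis
    using summable_shifted_rogers_sum[OF assms]
    by (simp add: suminf_diff[symmetric] suminf_mult[symmetric] summable_mult)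
qed

text \<open>Iterating the functional equation splits off the factors of the product. What remains is
the sum at \<open>x q ^ n\<close>, and it tends to \<open>1\<close> because in the limit only the term of index \<open>0\<close> survives.\<close>

lemma shifted_rogers_sum_eq_product:
  assumes "norm q < 1"
  shows "(\<Sum>n. shifted_rogers_term q x n) = qpoch_inf (- x * q) q"
proof -
  define F where "F x = (\<Sum>n. shifted_rogers_term q x n)" for x
  have "F x = qpoch (- x * q) q n * F (x * q ^ n)" for n
  proof (induction n)
    case (Suc n)
    have "F (x * q ^ n) = (1 + x * q ^ n * q) * F (x * q ^ n * q)"
      unfolding F_def by (rule shifted_rogers_sum_functional_eq[OF assms])
    then show ?case using Suc by (simp add: qpoch_Suc mult_ac)
  qed simp
  moreover have "(\<lambda>n. F (x * q ^ n)) \<longlonglongrightarrow> 1"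
  proof -
    let ?b = "\<lambda>k. q ^ (2 * (k * k) + k) * 0 ^ (2 * k) * inv_qfact (q ^ 2) k * 1"
    have "(\<lambda>n. F (x * q ^ n)) \<longlonglongrightarrow> (\<Sum>k. ?b k)"
      unfolding F_def
    proof (rule tannery_sequentially)
      show "(\<lambda>n. shifted_rogers_term q (x * q ^ n) k) \<longlonglongrightarrow> ?b k" for k
        unfolding shifted_rogers_term_def
        using assms rogers_series_LIMSEQ[OF assms, of "x * q ^ (2 * k)"]
        by (intro tendsto_mult tendsto_power tendsto_const tendsto_mult_right_zero LIMSEQ_power_zero)
           (simp_all add: mult_ac)
      show "norm (shifted_rogers_term q (x * q ^ n) k)
        \<le> norm (q ^ (2 * (k * k) + k) * x ^ (2 * k) * inv_qfact (q ^ 2) k)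
           * (\<Sum>k. norm (q ^ (k * k) * x ^ k * inv_qfact q k))" for n k
        using assms by (intro shifted_rogers_term_norm_le)
          (auto simp: norm_mult norm_power power_le_one mult_left_le)
      show "summable (\<lambda>k. norm (q ^ (2 * (k * k) + k) * x ^ (2 * k) * inv_qfact (q ^ 2) k)
           * (\<Sum>k. norm (q ^ (k * k) * x ^ k * inv_qfact q k)))"
        by (intro summable_mult2 summable_shifted_rogers_sum_weight assms)
    qed
    moreover have "(\<Sum>k. ?b k) = 1" using suminf_finite[of "{0}" ?b] by simp
    ultimately show ?thesis by simp
  qed
  then have "(\<lambda>n. qpoch (- x * q) q n * F (x * q ^ n)) \<longlonglongrightarrow> qpoch_inf (- x * q) q * 1"
    by (intro tendsto_mult qpoch_LIMSEQ assms)
  ultimately have "(\<lambda>n. F x) \<longlonglongrightarrow> qpoch_inf (- x * q) q * 1" by (simp only:)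
  then show ?thesis by (simp add: LIMSEQ_const_iff F_def)
qed

lemma summable_schur:
  assumes "norm q < 1" "\<And>m. norm (u m) \<le> B"
  shows "summable (\<lambda>n. q ^ (2*n) * u n / qpoch (q^2) (q^2) n)"
proof -
  have q2: "norm (q ^ 2) < 1" using norm_power_less_one[OF assms(1)] by simp
  obtain C where C: "C > 0" "\<And>n. norm (inv_qfact (q ^ 2) n) \<le> C" using inv_qfact_bounded[OF q2] by blast
  have geo: "summable (\<lambda>n. norm (q ^ 2) ^ n * (B * C))"
    using q2 by (intro summable_mult2 summable_geometric) simp
  show ?thesis
  proof (rule summable_comparison_test'[OF geo])
    fix n
    have "norm (q ^ (2*n) * u n / qpoch (q^2) (q^2) n) = norm (q ^ 2) ^ n * (norm (u n) * norm (inv_qfact (q ^ 2) n))"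
      by (simp add: norm_mult norm_divide norm_power power_mult inv_qfact_def)
    also have "\<dots> \<le> norm (q ^ 2) ^ n * (B * C)"
      using C assms(2) order_trans[OF norm_ge_zero assms(2)] by (intro mult_left_mono mult_mono) auto
    finally show "norm (q ^ (2*n) * u n / qpoch (q^2) (q^2) n) \<le> norm (q ^ 2) ^ n * (B * C)" .
  qed
qed

theorem theorem1p1:
  fixes q :: complex
  assumes "0 < norm q" and "norm q < 1"
  shows "summable (\<lambda>n. q ^ (2*n) * schur_a (2*n) q / qpoch (q^2) (q^2) n)
    \<and> summable (\<lambda>n. q ^ (2*n) * schur_b (2*n) q / qpoch (q^2) (q^2) n)
    \<and> summable (\<lambda>n. q ^ (2*n) * schur_a (2*n+1) q / qpoch (q^2) (q^2) n)
    \<and> summable (\<lambda>n. q ^ (2*n) * schur_b (2*n+1) q / qpoch (q^2) (q^2) n)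
    \<and> qpoch_inf (-q) q =
           1 / qpochs_inf [q, q^4] (q^5)
             * (\<Sum>n. q ^ (2*n) * schur_a (2*n) q / qpoch (q^2) (q^2) n)
         - 1 / qpochs_inf [q^2, q^3] (q^5)
             * (\<Sum>n. q ^ (2*n) * schur_b (2*n) q / qpoch (q^2) (q^2) n)
    \<and> qpoch_inf (-(q^2)) q =
           1 / qpochs_inf [q^2, q^3] (q^5)
             * (\<Sum>n. q ^ (2*n) * schur_b (2*n+1) q / qpoch (q^2) (q^2) n)
         - 1 / qpochs_inf [q, q^4] (q^5)
             * (\<Sum>n. q ^ (2*n) * schur_a (2*n+1) q / qpoch (q^2) (q^2) n)"
proof -
  have q: "norm q < 1" "q \<noteq> 0" using assms by auto
  let ?s = "\<lambda>u n. q ^ (2*n) * u n / qpoch (q^2) (q^2) n"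
  let ?A = "rogers_series q 1" and ?B = "rogers_series q q"
  obtain Ba where "\<And>m. norm (schur_a m q) \<le> Ba"
    using schur_recurrence_bounded[OF q(1), of "\<lambda>m. schur_a m q"] schur_a_rec[OF q(1)] by blast
  then have sa: "summable (?s (\<lambda>n. schur_a (2*n) q))" "summable (?s (\<lambda>n. schur_a (2*n+1) q))"
    by (auto intro!: summable_schur[OF q(1)])
  obtain Bb where "\<And>m. norm (schur_b m q) \<le> Bb"
    using schur_recurrence_bounded[OF q(1), of "\<lambda>m. schur_b m q"] schur_b_rec[OF q(1)] by blast
  then have sb: "summable (?s (\<lambda>n. schur_b (2*n) q))" "summable (?s (\<lambda>n. schur_b (2*n+1) q))"
    by (auto intro!: summable_schur[OF q(1)])
  have suminf_lin: "c * suminf f - d * suminf g = (\<Sum>n. c * f n - d * g n)"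
    if "summable f" "summable g" for c d :: complex and f g
    using that by (simp add: suminf_mult suminf_diff[symmetric] summable_mult)
  have lin: "c * ?s (\<lambda>_. u) n - d * ?s (\<lambda>_. v) n
      = q ^ (2*n) * (u * c - v * d) * inv_qfact (q ^ 2) n" for c d u v n
    by (simp add: inv_qfact_def diff_divide_distrib algebra_simps)
  \<comment> \<open>With this exponent the factor \<open>q ^ (2 n)\<close> of the series and the power of \<open>q\<close> in
    \<open>schur_rogers_combination\<close> combine to the coefficient in \<open>shifted_rogers_term\<close>.\<close>
  have even: "(2 * n choose 2) + 2 * n = 2 * (n * n) + n" for n
    using choose_two_add[of n n] square_eq_choose_two[of n] by (simp add: mult_2)
  have "?A * suminf (?s (\<lambda>n. schur_a (2*n) q)) - ?B * suminf (?s (\<lambda>n. schur_b (2*n) q))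
      = (\<Sum>n. ?A * ?s (\<lambda>n. schur_a (2*n) q) n - ?B * ?s (\<lambda>n. schur_b (2*n) q) n)"
    by (intro suminf_lin sa sb)
  also have "\<dots> = (\<Sum>n. shifted_rogers_term q 1 n)"
  proof (rule suminf_cong)
    fix n
    have "q ^ (2 * n) * q ^ (2 * n choose 2) = q ^ (2 * (n * n) + n)"
      unfolding even[symmetric] power_add by (rule mult.commute)
    then show "?A * ?s (\<lambda>n. schur_a (2*n) q) n - ?B * ?s (\<lambda>n. schur_b (2*n) q) n = shifted_rogers_term q 1 n"
      unfolding lin schur_rogers_combination[OF q(1)] shifted_rogers_term_def
      by (simp add: mult_ac)
  qed
  also have "\<dots> = qpoch_inf (-q) q" using shifted_rogers_sum_eq_product[OF q(1), of 1] by simp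
  finally have first: "?A * suminf (?s (\<lambda>n. schur_a (2*n) q)) - ?B * suminf (?s (\<lambda>n. schur_b (2*n) q))
      = qpoch_inf (-q) q" .
  have "?B * suminf (?s (\<lambda>n. schur_b (2*n+1) q)) - ?A * suminf (?s (\<lambda>n. schur_a (2*n+1) q))
      = (\<Sum>n. ?B * ?s (\<lambda>n. schur_b (2*n+1) q) n - ?A * ?s (\<lambda>n. schur_a (2*n+1) q) n)"
    by (intro suminf_lin sa sb)
  also have "\<dots> = (\<Sum>n. shifted_rogers_term q q n)"
  proof (rule suminf_cong)
    fix n
    have "schur_b (2*n+1) q * ?B - schur_a (2*n+1) q * ?A = q ^ (2*n+1 choose 2) * rogers_series q (q ^ (2*n+1))"
      using schur_rogers_combination[OF q(1), of "2*n+1"] by (simp add: algebra_simps)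
    also have "(2 * n + 1 choose 2) = 2 * (n * n) + n"
      using even[of n] by (simp add: choose_two_Suc)
    finally show "?B * ?s (\<lambda>n. schur_b (2*n+1) q) n - ?A * ?s (\<lambda>n. schur_a (2*n+1) q) n = shifted_rogers_term q q n"
      unfolding lin shifted_rogers_term_def by (simp add: mult_ac)
  qed
  also have "\<dots> = qpoch_inf (-(q^2)) q"
    using shifted_rogers_sum_eq_product[OF q(1), of q] by (simp add: power2_eq_square)
  finally have second: "?B * suminf (?s (\<lambda>n. schur_b (2*n+1) q)) - ?A * suminf (?s (\<lambda>n. schur_a (2*n+1) q))
      = qpoch_inf (-(q^2)) q" .
  show ?thesis
    using sa sb first second rogers_ramanujan_first[OF q] rogers_ramanujan_second[OF q] by simp
qed

end
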